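(* Let $n\ge 5$ and let $f\in\mathcal{L}_{n,q}$ be an $(n-2)$-club polynomial. Then $f$ is equivalent to a polynomial $p(x)=\mathrm{Tr}_{q^n/q}(\xi x)+b\,\mathrm{Tr}_{q^n/q}(\eta x)$, where $b\in\mathbb{F}_{q^n}\setminus\mathbb{F}_q$, $\xi,\eta\in\mathbb{F}_{q^n}^*$, and $\langle\xi,\eta\rangle_{\mathbb{F}_q}^\perp=\overline{S}\oplus c\langle 1,b,\ldots,b^{t-3}\rangle_{\mathbb{F}_q}$ (the second summand being $\{0\}$ when $t=2$) with $t=[\mathbb{F}_q(b):\mathbb{F}_q]$, $c\in\mathbb{F}_{q^n}^*$, and $\overline{S}$ an $\mathbb{F}_{q^t}$-subspace of $\mathbb{F}_{q^n}$ of $\mathbb{F}_{q^t}$-dimension $n/t-1$.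
   Context: $q$ is a prime power; $\mathcal{L}_{n,q}$ is the set of $q$-polynomials $\sum_i c_ix^{q^i}$ with $c_i\in\mathbb{F}_{q^n}$. For $g\in\mathcal{L}_{n,q}$, $U_g=\{(x,g(x)):x\in\mathbb{F}_{q^n}\}$, $L_{U_g}=\{\langle u\rangle_{\mathbb{F}_{q^n}}:u\in U_g\setminus\{0\}\}\subseteq\mathrm{PG}(1,q^n)$, and the weight of $P=\langle v\rangle_{\mathbb{F}_{q^n}}$ is $\dim_{\mathbb{F}_q}(U_g\cap\langle v\rangle_{\mathbb{F}_{q^n}})$. $g$ is an $(n-2)$-club polynomial if $L_{U_g}$ has exactly one point of weight $n-2$ and all other points of weight $1$. Two polynomials $f,g\in\mathcal{L}_{n,q}$ are equivalent if some $\varphi\in\Gamma\mathrm{L}(3,q^n)$, acting naturally on the points of $\mathrm{PG}(2,q^n)$, maps the graph $\mathcal{G}_f=\{\langle(x,f(x),1)\rangle_{\mathbb{F}_{q^n}}:x\in\mathbb{F}_{q^n}\}$ onto $\mathcal{G}_g$. $\perp$ is with respect to $(x,y)\mapsto\mathrm{Tr}_{q^n/q}(xy)$. *)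

theory Defs
  imports "HOL-Analysis.Cartesian_Space" "HOL-Computational_Algebra.Polynomial"
    "HOL-Number_Theory.Prime_Powers"
begin

text \<open>
  The field $F_{q^n}$ is a type of class \<open>field\<close> and \<open>finite\<close> with \<open>q ^ n\<close> elements.
  Its subfields are subsets of that type, so linear algebra over them is set up
  relative to a set \<open>F\<close> of scalars.
\<close>

definition subspace_over :: "'k set \<Rightarrow> ('k \<Rightarrow> 'v \<Rightarrow> 'v) \<Rightarrow> 'v::ab_group_add set \<Rightarrow> bool" where
  "subspace_over F smul V \<longleftrightarrow>
     0 \<in> V \<and> (\<forall>u\<in>V. \<forall>v\<in>V. u + v \<in> V) \<and> (\<forall>a\<in>F. \<forall>v\<in>V. smul a v \<in> V)"

definition span_over :: "'k set \<Rightarrow> ('k \<Rightarrow> 'v \<Rightarrow> 'v) \<Rightarrow> 'v::ab_group_add set \<Rightarrow> 'v set" where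
  "span_over F smul S =
     {\<Sum>v\<in>T. smul (r v) v | T r. finite T \<and> T \<subseteq> S \<and> (\<forall>v\<in>T. r v \<in> F)}"

definition independent_over ::
  "'k::zero set \<Rightarrow> ('k \<Rightarrow> 'v \<Rightarrow> 'v) \<Rightarrow> 'v::ab_group_add set \<Rightarrow> bool" where
  "independent_over F smul B \<longleftrightarrow>
     (\<forall>T r. finite T \<and> T \<subseteq> B \<and> (\<forall>v\<in>T. r v \<in> F) \<and> (\<Sum>v\<in>T. smul (r v) v) = 0
        \<longrightarrow> (\<forall>v\<in>T. r v = 0))"

definition dim_over ::
  "'k::zero set \<Rightarrow> ('k \<Rightarrow> 'v \<Rightarrow> 'v) \<Rightarrow> 'v::ab_group_add set \<Rightarrow> nat" where
  "dim_over F smul V =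
     card (SOME B. independent_over F smul B \<and> span_over F smul B = span_over F smul V)"

definition is_direct_sum :: "'v::ab_group_add set \<Rightarrow> 'v set \<Rightarrow> 'v set \<Rightarrow> bool" where
  "is_direct_sum V A B \<longleftrightarrow> V = {a + b | a b. a \<in> A \<and> b \<in> B} \<and> A \<inter> B = {0}"

text \<open>The subfield with \<open>m\<close> elements, for \<open>m = q ^ t\<close> and \<open>t\<close> dividing \<open>n\<close>.\<close>

definition GF :: "nat \<Rightarrow> 'a::field set" where
  "GF m = {x. x ^ m = x}"

definition is_subfield :: "'a::field set \<Rightarrow> bool" where
  "is_subfield L \<longleftrightarrow> 0 \<in> L \<and> 1 \<in> L \<and>
     (\<forall>x\<in>L. \<forall>y\<in>L. x - y \<in> L \<and> x * y \<in> L) \<and> (\<forall>x\<in>L. inverse x \<in> L)"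

definition adjoin :: "'a::field set \<Rightarrow> 'a \<Rightarrow> 'a set" where
  "adjoin K b = \<Inter>{L. is_subfield L \<and> K \<subseteq> L \<and> b \<in> L}"

definition ext_degree :: "'a::field set \<Rightarrow> 'a set \<Rightarrow> nat" where
  "ext_degree L K = dim_over K times L"

text \<open>
  $\mathrm{Tr}_{q^n/q}$. It is polymorphic so that for \<open>\<xi>\<close> in the field,
  \<open>Tr q n [:0, \<xi>:]\<close> is the polynomial $\mathrm{Tr}_{q^n/q}(\xi x)$ in the indeterminate $x$.
\<close>

definition Tr :: "nat \<Rightarrow> nat \<Rightarrow> 'r::comm_semiring_1 \<Rightarrow> 'r" where
  "Tr q n x = (\<Sum>i<n. x ^ (q ^ i))"

definition trace_perp :: "nat \<Rightarrow> nat \<Rightarrow> 'a::field set \<Rightarrow> 'a set" where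
  "trace_perp q n A = {y. \<forall>x\<in>A. Tr q n (x * y) = 0}"

text \<open>
  No bound on the number of terms is imposed: reduction modulo $x^{q^n}-x$ does not change
  the associated function.
\<close>

definition q_polys :: "nat \<Rightarrow> 'a::field poly set" where
  "q_polys q = {\<Sum>i<m. monom (c i) (q ^ i) | m c. True}"

definition U_set :: "'a::field poly \<Rightarrow> ('a^2) set" where
  "U_set g = {vector [x, poly g x] | x. True}"

definition L_set :: "'a::field poly \<Rightarrow> ('a^2) set set" where
  "L_set g = {vec.span {u} | u. u \<in> U_set g - {0}}"

definition weight :: "nat \<Rightarrow> 'a::field poly \<Rightarrow> ('a^2) set \<Rightarrow> nat" where
  "weight q g P = dim_over (GF q) vector_scalar_mult (U_set g \<inter> P)"

definition club_poly :: "nat \<Rightarrow> nat \<Rightarrow> 'a::field poly \<Rightarrow> bool" where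
  "club_poly q i g \<longleftrightarrow>
     (\<exists>!P. P \<in> L_set g \<and> weight q g P = i) \<and>
     (\<forall>P\<in>L_set g. weight q g P \<noteq> i \<longrightarrow> weight q g P = 1)"

definition field_automorphism :: "('a::field \<Rightarrow> 'a) \<Rightarrow> bool" where
  "field_automorphism \<sigma> \<longleftrightarrow> bij \<sigma> \<and> \<sigma> 1 = 1 \<and>
     (\<forall>x y. \<sigma> (x + y) = \<sigma> x + \<sigma> y) \<and> (\<forall>x y. \<sigma> (x * y) = \<sigma> x * \<sigma> y)"

definition GammaL3 :: "('a::field^3 \<Rightarrow> 'a^3) set" where
  "GammaL3 = {\<phi>. bij \<phi> \<and> (\<forall>u v. \<phi> (u + v) = \<phi> u + \<phi> v) \<and>
     (\<exists>\<sigma>. field_automorphism \<sigma> \<and> (\<forall>a v. \<phi> (a *s v) = \<sigma> a *s \<phi> v))}"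

definition graph_points :: "'a::field poly \<Rightarrow> ('a^3) set set" where
  "graph_points f = {vec.span {vector [x, poly f x, 1]} | x. True}"

definition poly_equivalent :: "nat \<Rightarrow> 'a::field poly \<Rightarrow> 'a poly \<Rightarrow> bool" where
  "poly_equivalent q f g \<longleftrightarrow> f \<in> q_polys q \<and> g \<in> q_polys q \<and>
     (\<exists>\<phi>\<in>GammaL3. (\<lambda>P. \<phi> ` P) ` graph_points f = graph_points g)"

end

theory Submission imports Defs begin

text \<open>
  Let \<open>K = GF q\<close> and let \<open>m\<^sub>0\<close> be the slope of the point of weight \<open>n - 2\<close>. The \<open>K\<close>-linear map
  \<open>x \<mapsto> f x - m\<^sub>0 x\<close> has rank 2, so it is \<open>a (Tr(\<xi> x) + b Tr(\<eta> x))\<close> for some \<open>a \<noteq> 0\<close> and \<open>b \<notin> K\<close>.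
  A second point of weight at least 2 is the same as some \<open>\<lambda>\<close> with \<open>Tr(\<lambda>\<xi>) = Tr(\<lambda>\<eta>b) = 1\<close> and
  \<open>Tr(\<lambda>\<eta>) = Tr(\<lambda>\<xi>b) = 0\<close>. By duality such a \<open>\<lambda>\<close> fails to exist only if there is a relation
  \<open>\<alpha>\<xi> + \<beta>\<eta> + \<gamma>\<xi>b + \<delta>\<eta>b = 0\<close> over \<open>K\<close> with \<open>\<alpha> + \<delta> \<noteq> 0\<close>, which puts \<open>\<xi>\<close> and \<open>\<eta>\<close> into
  \<open>d\<langle>1, b\<rangle>\<close> for some \<open>d \<noteq> 0\<close>.

  It remains to decompose \<open>\<langle>d, db\<rangle>\<^sup>\<bottom>\<close>. With \<open>L = K(b)\<close>, it contains the \<open>L\<close>-subspace \<open>(dL)\<^sup>\<bottom>\<close>, and also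
  \<open>c\<langle>1, b, \<dots>, b\<^bsup>t-3\<^esup>\<rangle>\<close> whenever \<open>cd\<close> is orthogonal to \<open>1, b, \<dots>, b\<^bsup>t-2\<^esup>\<close>. Choosing \<open>cd\<close> not
  orthogonal to \<open>b\<^bsup>t-1\<^esup>\<close> makes the sum direct, and the cardinalities agree.
\<close>

section \<open>Subfields as sets, and counting by fibres\<close>

lemma is_subfieldD:
  assumes "is_subfield F"
  shows is_subfield_0: "0 \<in> F" and is_subfield_1: "1 \<in> F"
    and is_subfield_diff: "x \<in> F \<Longrightarrow> y \<in> F \<Longrightarrow> x - y \<in> F"
    and is_subfield_mult: "x \<in> F \<Longrightarrow> y \<in> F \<Longrightarrow> x * y \<in> F"
    and is_subfield_inverse: "x \<in> F \<Longrightarrow> inverse x \<in> F"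
  using assms unfolding is_subfield_def by auto

lemma is_subfield_uminus: "is_subfield F \<Longrightarrow> x \<in> F \<Longrightarrow> - x \<in> F"
  using is_subfield_diff[of F 0 x] is_subfield_0 by auto

lemma is_subfield_add: "is_subfield F \<Longrightarrow> x \<in> F \<Longrightarrow> y \<in> F \<Longrightarrow> x + y \<in> F"
  using is_subfield_diff[of F x "- y"] is_subfield_uminus by auto

lemma is_subfield_divide: "is_subfield F \<Longrightarrow> x \<in> F \<Longrightarrow> y \<in> F \<Longrightarrow> x / y \<in> F"
  using is_subfield_mult[of F x "inverse y"] is_subfield_inverse by (auto simp: field_simps)

lemma is_subfield_power: "is_subfield F \<Longrightarrow> x \<in> F \<Longrightarrow> x ^ k \<in> F"
  by (induction k) (auto intro: is_subfield_1 is_subfield_mult)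

text \<open>Multiplication by \<open>x \<noteq> 0\<close> permutes \<open>F - {0}\<close>, so the
  factor \<open>x ^ (card F - 1)\<close> leaves the product of all nonzero elements unchanged; that
  product is nonzero and cancels.\<close>

lemma is_subfield_power_card:
  fixes F :: "'a::{field,finite} set"
  assumes F: "is_subfield F" and x: "x \<in> F"
  shows "x ^ card F = x"
proof (cases "x = 0")
  case True
  have "card F > 0" using is_subfield_0[OF F] by (auto simp: card_gt_0_iff)
  then show ?thesis using True by simp
next
  case False
  have "x * (\<Prod>y\<in>F-{0}. x * y) = x * x ^ (card F - 1) * \<Prod>(F-{0})"
    using is_subfield_0[OF F] by (simp add: prod.distrib mult_ac)
  also have "x * x ^ (card F - 1) = x ^ Suc (card F - 1)"
    by simp
  also have "Suc (card F - 1) = card F"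
    using is_subfield_0[OF F] card_gt_0_iff[of F] by auto
  also have "(\<Prod>y\<in>F-{0}. x * y) = (\<Prod>y\<in>F-{0}. y)"
    by (rule prod.reindex_bij_witness[of _ "\<lambda>y. y / x" "\<lambda>y. x * y"])
      (use False F x in \<open>auto intro: is_subfield_mult is_subfield_divide\<close>)
  finally show ?thesis by simp
qed

text \<open>Every nonempty fibre of \<open>T\<close> is a translate of \<open>A\<close>. This count
  stands in for the rank-nullity theorem below.\<close>

lemma card_eq_card_fiber_mult_card_range:
  fixes T :: "'a::{ab_group_add,finite} \<Rightarrow> 'b" and A :: "'a set"
  assumes "\<And>x y. T x = T y \<longleftrightarrow> x - y \<in> A"
  shows "CARD('a) = card A * card (range T)"
proof -
  have "card {x. T x = y} = card A" if y: "y \<in> range T" for y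
  proof -
    obtain x0 where x0: "y = T x0" using y by auto
    have "bij_betw (\<lambda>a. a + x0) A {x. T x = y}"
      unfolding x0 using assms
      by (intro bij_betwI[of _ _ _ "\<lambda>x. x - x0"]) auto
    then show ?thesis using bij_betw_same_card by metis
  qed
  then have "(\<Sum>y\<in>range T. card {x. T x = y}) = card (range T) * card A" by simp
  moreover have "CARD('a) = (\<Sum>y\<in>range T. card {x. T x = y})"
    using sum.image_gen[of "UNIV :: 'a set" "\<lambda>_. 1::nat" T] by simp
  ultimately show ?thesis by (simp add: mult.commute)
qed

section \<open>Linear algebra over a subfield\<close>

text \<open>Working inside a vector space over the full field supplies the scalar laws; only the
  coefficients are restricted to \<open>F\<close>. The locale serves for \<open>times\<close> with
  \<open>F = K\<close> and with \<open>F\<close> equal to K(b), and for pairs over the field with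
  \<open>F = K\<close>.\<close>

locale subfield_space = vector_space scale
  for scale :: "'k::field \<Rightarrow> 'v::ab_group_add \<Rightarrow> 'v" (infixr \<open>*S\<close> 75) +
  fixes F :: "'k set"
  assumes subfield: "is_subfield F"
begin

lemmas F_intros = is_subfield_0[OF subfield] is_subfield_1[OF subfield]
  is_subfield_diff[OF subfield] is_subfield_mult[OF subfield] is_subfield_inverse[OF subfield]
  is_subfield_add[OF subfield] is_subfield_uminus[OF subfield] is_subfield_divide[OF subfield]

lemma subspace_over_sum:
  assumes "subspace_over F scale V" "\<And>v. v \<in> T \<Longrightarrow> g v \<in> V"
  shows "sum g T \<in> V"
  using assms(2) by (induction T rule: infinite_finite_induct)
    (use assms(1) in \<open>auto simp: subspace_over_def\<close>)

lemma subspace_over_uminus: "subspace_over F scale V \<Longrightarrow> v \<in> V \<Longrightarrow> - v \<in> V"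
  using F_intros(7)[OF F_intros(2)] unfolding subspace_over_def
  by (metis scale_minus_left scale_one)

lemma subspace_over_diff: "subspace_over F scale V \<Longrightarrow> u \<in> V \<Longrightarrow> v \<in> V \<Longrightarrow> u - v \<in> V"
  using subspace_over_uminus[of V v] unfolding subspace_over_def
  by (metis uminus_add_conv_diff add.commute)

lemma span_over_finite:
  assumes "finite B"
  shows "span_over F scale B = {\<Sum>v\<in>B. r v *S v | r. \<forall>v\<in>B. r v \<in> F}"
proof -
  have "\<exists>r'. (\<Sum>v\<in>T. r v *S v) = (\<Sum>v\<in>B. r' v *S v) \<and> (\<forall>v\<in>B. r' v \<in> F)"
    if "T \<subseteq> B" "\<forall>v\<in>T. r v \<in> F" for T r
  proof (intro exI[of _ "\<lambda>v. if v \<in> T then r v else 0"] conjI)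
    show "(\<Sum>v\<in>T. r v *S v) = (\<Sum>v\<in>B. (if v \<in> T then r v else 0) *S v)"
      using that(1) assms by (intro sum.mono_neutral_cong_left) auto
  qed (use that F_intros in auto)
  then show ?thesis unfolding span_over_def using assms by blast
qed

lemma span_over_superset: "B \<subseteq> span_over F scale B"
proof
  fix v assume "v \<in> B"
  then have "(\<Sum>u\<in>{v}. 1 *S u) \<in> span_over F scale B"
    unfolding span_over_def using F_intros
    by (intro CollectI exI[of _ "{v}"] exI[of _ "\<lambda>_. 1"]) auto
  then show "v \<in> span_over F scale B" by simp
qed

lemma span_over_minimal:
  assumes "subspace_over F scale V" "B \<subseteq> V"
  shows "span_over F scale B \<subseteq> V"
  using assms unfolding span_over_def
  by (auto intro!: subspace_over_sum simp: subspace_over_def)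

lemma span_over_subspace: "subspace_over F scale V \<Longrightarrow> span_over F scale V = V"
  using span_over_minimal[of V V] span_over_superset by auto

lemma subspace_over_span:
  assumes "finite B"
  shows "subspace_over F scale (span_over F scale B)"
proof -
  let ?S = "span_over F scale B"
  have I: "(\<Sum>v\<in>B. r v *S v) \<in> ?S" if "\<forall>v\<in>B. r v \<in> F" for r
    using that unfolding span_over_finite[OF assms] by blast
  have "0 \<in> ?S" using I[of "\<lambda>_. 0"] F_intros by simp
  moreover have "u + v \<in> ?S" if uv: "u \<in> ?S" "v \<in> ?S" for u v
  proof -
    obtain r s where "u = (\<Sum>v\<in>B. r v *S v)" "\<forall>v\<in>B. r v \<in> F"
      "v = (\<Sum>v\<in>B. s v *S v)" "\<forall>v\<in>B. s v \<in> F"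
      using uv unfolding span_over_finite[OF assms] by blast
    then show ?thesis using I[of "\<lambda>v. r v + s v"] F_intros
      by (simp add: scale_left_distrib sum.distrib)
  qed
  moreover have "a *S u \<in> ?S" if u: "u \<in> ?S" and a: "a \<in> F" for a u
  proof -
    obtain r where "u = (\<Sum>v\<in>B. r v *S v)" "\<forall>v\<in>B. r v \<in> F"
      using u unfolding span_over_finite[OF assms] by blast
    then show ?thesis using I[of "\<lambda>v. a * r v"] F_intros a
      by (simp add: scale_sum_right)
  qed
  ultimately show ?thesis unfolding subspace_over_def by blast
qed

lemma independent_over_coeffs_unique:
  assumes "independent_over F scale B" "finite B"
    and "\<forall>v\<in>B. r v \<in> F" "\<forall>v\<in>B. s v \<in> F" "(\<Sum>v\<in>B. r v *S v) = (\<Sum>v\<in>B. s v *S v)" "v \<in> B"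
  shows "r v = s v"
proof -
  have "(\<Sum>v\<in>B. (r v - s v) *S v) = 0"
    using assms(5) by (simp add: scale_left_diff_distrib sum_subtractf)
  moreover have "\<forall>v\<in>B. r v - s v \<in> F" using assms(3,4) F_intros(3) by blast
  ultimately have "\<forall>v\<in>B. r v - s v = 0"
    using assms(1)[unfolded independent_over_def, rule_format, of B "\<lambda>v. r v - s v"] assms(2)
    by blast
  then show ?thesis using assms(6) by auto
qed

text \<open>Independence makes the map from coefficient families to sums injective; extensional
  functions on \<open>B\<close> make the family itself unique.\<close>

lemma card_span_independent:
  assumes "independent_over F scale B" "finite B"
  shows "card (span_over F scale B) = card F ^ card B"
proof -
  have "bij_betw (\<lambda>r. \<Sum>v\<in>B. r v *S v) (B \<rightarrow>\<^sub>E F) (span_over F scale B)"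
  proof (rule bij_betw_imageI)
    show "inj_on (\<lambda>r. \<Sum>v\<in>B. r v *S v) (B \<rightarrow>\<^sub>E F)"
    proof (rule inj_onI)
      fix r s assume rs: "r \<in> B \<rightarrow>\<^sub>E F" "s \<in> B \<rightarrow>\<^sub>E F" "(\<Sum>v\<in>B. r v *S v) = (\<Sum>v\<in>B. s v *S v)"
      then have "r v = s v" if "v \<in> B" for v
        using independent_over_coeffs_unique[OF assms, of r s v] that by auto
      then show "r = s" using rs by (intro PiE_ext) auto
    qed
    show "(\<lambda>r. \<Sum>v\<in>B. r v *S v) ` (B \<rightarrow>\<^sub>E F) = span_over F scale B"
    proof -
      have "\<exists>r'\<in>B \<rightarrow>\<^sub>E F. (\<Sum>v\<in>B. r v *S v) = (\<Sum>v\<in>B. r' v *S v)" if "\<forall>v\<in>B. r v \<in> F" for r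
        using that by (intro bexI[of _ "restrict r B"]) auto
      then show ?thesis unfolding span_over_finite[OF assms(2)]
        by (force simp: image_iff)
    qed
  qed
  then have "card (B \<rightarrow>\<^sub>E F) = card (span_over F scale B)" by (rule bij_betw_same_card)
  then show ?thesis using assms(2) by (simp add: card_PiE)
qed

text \<open>A relation with nonzero coefficient at \<open>v\<close> could be solved for
  \<open>v\<close> inside \<open>F\<close>, which would place \<open>v\<close> in the span.\<close>

lemma independent_over_insert:
  assumes B: "independent_over F scale B" "finite B" and v: "v \<notin> span_over F scale B"
  shows "independent_over F scale (insert v B)"
  unfolding independent_over_def
proof (intro allI impI, elim conjE)
  fix T r assume T: "finite T" "T \<subseteq> insert v B" "\<forall>v\<in>T. r v \<in> F" "(\<Sum>v\<in>T. r v *S v) = 0"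
  have *: "\<forall>u\<in>T - {v}. r u = 0" if "(\<Sum>u\<in>T - {v}. r u *S u) = 0"
    using B(1)[unfolded independent_over_def, rule_format, of "T - {v}" r] T that by auto
  show "\<forall>v\<in>T. r v = 0"
  proof (cases "v \<in> T")
    case True
    then have eq: "r v *S v + (\<Sum>u\<in>T - {v}. r u *S u) = 0"
      using T sum.remove[of T v "\<lambda>v. r v *S v"] by auto
    have "r v = 0"
    proof (rule ccontr)
      assume nz: "r v \<noteq> 0"
      have "r v *S v = (\<Sum>u\<in>T - {v}. (- r u) *S u)"
        using eq by (simp add: sum_negf eq_neg_iff_add_eq_0)
      then have "inverse (r v) *S (r v *S v) = (\<Sum>u\<in>T - {v}. (inverse (r v) * - r u) *S u)"
        by (simp add: scale_sum_right)
      then have "v = (\<Sum>u\<in>T - {v}. (inverse (r v) * - r u) *S u)"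
        using nz by simp
      moreover have "(\<Sum>u\<in>T - {v}. (inverse (r v) * - r u) *S u) \<in> span_over F scale B"
        unfolding span_over_def using T True
        by (intro CollectI exI[of _ "T - {v}"] exI[of _ "\<lambda>u. inverse (r v) * - r u"] conjI refl)
          (auto intro!: F_intros(3-) simp del: mult_minus_right)
      ultimately show False using v by simp
    qed
    then show ?thesis using * eq by auto
  next
    case False
    then show ?thesis using * T by auto
  qed
qed

lemma independent_over_empty: "independent_over F scale {}"
  unfolding independent_over_def by auto

text \<open>As \<open>V\<close> is finite, there is a maximal independent set between
  \<open>B\<close> and \<open>V\<close>; by \<open>independent_over_insert\<close> nothing of
  \<open>V\<close> lies outside its span.\<close>

lemma independent_over_extend_basis:
  assumes V: "subspace_over F scale V" "finite V" and B: "independent_over F scale B" "B \<subseteq> V"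
  obtains B' where "B \<subseteq> B'" "B' \<subseteq> V" "independent_over F scale B'" "span_over F scale B' = V"
proof -
  let ?C = "{C. B \<subseteq> C \<and> C \<subseteq> V \<and> independent_over F scale C}"
  have "?C \<subseteq> Pow V" by auto
  then have "finite ?C" using V(2) finite_subset by blast
  moreover have "?C \<noteq> {}" using B by auto
  ultimately obtain M where M: "M \<in> ?C" "\<forall>C\<in>?C. M \<subseteq> C \<longrightarrow> M = C"
    using finite_has_maximal[of ?C] by auto
  have fin: "finite M" using M(1) V(2) finite_subset by auto
  have "V \<subseteq> span_over F scale M"
  proof
    fix v assume "v \<in> V"
    show "v \<in> span_over F scale M"
    proof (rule ccontr)
      assume v: "v \<notin> span_over F scale M"
      then have "insert v M \<in> ?C"
        using M(1) \<open>v \<in> V\<close> independent_over_insert[OF _ fin v] by auto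
      then have "v \<in> M" using M(2) by blast
      then show False using v span_over_superset by blast
    qed
  qed
  then show ?thesis using that[of M] M(1) span_over_minimal[OF V(1), of M] by auto
qed

lemma obtain_basis:
  assumes V: "subspace_over F scale V" "finite V"
  obtains B where "B \<subseteq> V" "independent_over F scale B" "span_over F scale B = V"
  using independent_over_extend_basis[OF V independent_over_empty] by auto

text \<open>The choice in \<open>dim_over\<close> returns a basis because one exists. From here on
  dimensions are read off from cardinalities.\<close>

lemma card_eq_power_dim:
  assumes V: "subspace_over F scale V" "finite V"
  shows "card V = card F ^ dim_over F scale V"
proof -
  let ?P = "\<lambda>B. independent_over F scale B \<and> span_over F scale B = span_over F scale V"
  have "\<exists>B. ?P B" using obtain_basis[OF V] span_over_subspace[OF V(1)] by metis
  then have P: "?P (Eps ?P)" by (rule someI_ex)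
  then have "Eps ?P \<subseteq> V" using span_over_superset span_over_subspace[OF V(1)] by blast
  then have "finite (Eps ?P)" using V(2) finite_subset by blast
  then show ?thesis using card_span_independent[of "Eps ?P"] P span_over_subspace[OF V(1)]
    unfolding dim_over_def by simp
qed

text \<open>For \<open>scale = (*)\<close> this rule would reassociate products to the left, against \<open>mult.assoc\<close>.\<close>

declare scale_scale [simp del]

end

section \<open>Finite fields and the trace form\<close>

lemma subfield_space_times: "is_subfield F \<Longrightarrow> subfield_space (times :: 'a::field \<Rightarrow> _) F"
  by unfold_locales (auto simp: algebra_simps)

text \<open>The elements of \<open>GF m\<close> are the roots of x^m - x, and \<open>m > 1\<close>
  keeps the leading term from cancelling.\<close>

lemma card_GF_le:
  assumes "m > 1"
  shows "card (GF m :: 'a::field set) \<le> m"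
proof -
  define P :: "'a poly" where "P = monom 1 m - monom 1 1"
  have "coeff P m = 1" using assms by (simp add: P_def)
  then have "P \<noteq> 0" by auto
  then have "card {x. poly P x = 0} \<le> degree P" by (rule card_poly_roots_bound)
  also have "\<dots> \<le> m"
    unfolding P_def using assms by (intro degree_diff_le order.trans[OF degree_monom_le]) auto
  also have "{x. poly P x = 0} = GF m" by (auto simp: P_def GF_def poly_monom)
  finally show ?thesis .
qed

lemma linear_poly_power: "[:0, c:] ^ k = monom (c ^ k) k" for c :: "'a::comm_semiring_1"
proof -
  have "[:0, c:] = monom c 1" by (simp add: monom_altdef)
  then show ?thesis by (simp add: monom_power)
qed

lemma Tr_linear_poly: "Tr q n [:0, c:] = (\<Sum>i<n. monom (c ^ q ^ i) (q ^ i))"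
  unfolding Tr_def by (simp add: linear_poly_power)

lemma poly_Tr_linear: "poly (Tr q n [:0, c:]) x = Tr q n (c * x)"
  by (simp add: Tr_linear_poly Tr_def poly_sum poly_monom power_mult_distrib mult.commute)

lemma is_subfield_adjoin: "is_subfield (adjoin K b)"
  unfolding is_subfield_def adjoin_def by blast

lemma adjoin_superset: "K \<subseteq> adjoin K b" and adjoin_gen: "b \<in> adjoin K b"
  unfolding adjoin_def by auto

locale finite_field_extension =
  fixes q n :: nat and ty :: "'a::{field,finite} itself"
  assumes primepow_q: "primepow q" and card_field: "CARD('a) = q ^ n" and n_pos: "n > 0"
begin

abbreviation "K \<equiv> GF q :: 'a set"

lemma q_gt_1: "q > 1"
  using primepow_gt_Suc_0[OF primepow_q] by simp

lemma frobenius_add: "(x + y :: 'a) ^ q ^ i = x ^ q ^ i + y ^ q ^ i"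
proof -
  obtain p k where p: "prime p" "k > 0" "q = p ^ k"
    using primepow_q unfolding primepow_def by auto
  have pr: "prime (CHAR('a))"
    using prime_CHAR_semidom[where ?'a = 'a] finite_imp_CHAR_pos[where ?'a = 'a] by simp
  \<comment> \<open>Translation by 1 permutes the field, so \<open>CARD('a)\<close> copies of 1 add
    up to 0. Hence the characteristic divides a power of \<open>p\<close>.\<close>
  have "(\<Sum>x\<in>UNIV. x + 1 :: 'a) = (\<Sum>x\<in>UNIV. x)"
    by (rule sum.reindex_bij_witness[of _ "\<lambda>x. x - 1" "\<lambda>x. x + 1"]) auto
  then have "of_nat (CARD('a)) = (0 :: 'a)" by (simp add: sum.distrib)
  then have "CHAR('a) dvd p ^ (k * n)"
    unfolding of_nat_eq_0_iff_char_dvd card_field p(3) by (simp only: power_mult)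
  then have "CHAR('a) = p"
    using pr p(1) prime_dvd_power primes_dvd_imp_eq by blast
  then show ?thesis
    using freshmans_dream'[OF pr, of "q ^ i" "k * i" x y] p(3) by (simp add: power_mult)
qed

lemma frobenius_uminus: "(- x :: 'a) ^ q ^ i = - (x ^ q ^ i)"
  using frobenius_add[of x "- x" i] q_gt_1 by (simp add: power_0_left eq_neg_iff_add_eq_0 add.commute)

lemma frobenius_diff: "(x - y :: 'a) ^ q ^ i = x ^ q ^ i - y ^ q ^ i"
  using frobenius_add[of x "- y" i] frobenius_uminus by simp

lemma frobenius_fixed: "x \<in> K \<Longrightarrow> x ^ q ^ i = x"
  by (induction i) (auto simp: GF_def power_mult mult.commute[of q] simp del: power_Suc simp: power_Suc2)

lemma power_card_field: "(x :: 'a) ^ q ^ n = x"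
proof -
  have "is_subfield (UNIV :: 'a set)" by (simp add: is_subfield_def)
  from is_subfield_power_card[OF this, of x] show ?thesis by (simp add: card_field)
qed

lemma is_subfield_GF: "is_subfield K"
  using frobenius_diff[of _ _ 1] q_gt_1
  by (auto simp: is_subfield_def GF_def power_mult_distrib power_inverse)

sublocale K: subfield_space times K
  using subfield_space_times is_subfield_GF .

lemma Tr_add: "Tr q n (x + y :: 'a) = Tr q n x + Tr q n y"
  by (simp add: Tr_def frobenius_add sum.distrib)

lemma Tr_0: "Tr q n (0 :: 'a) = 0"
  using q_gt_1 by (simp add: Tr_def power_0_left)

lemma Tr_diff: "Tr q n (x - y :: 'a) = Tr q n x - Tr q n y"
  by (simp add: Tr_def frobenius_diff sum_subtractf)

lemma Tr_scale: "a \<in> K \<Longrightarrow> Tr q n (a * x) = a * Tr q n x"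
  by (simp add: Tr_def power_mult_distrib frobenius_fixed sum_distrib_left)

text \<open>Raising to the power \<open>q\<close> shifts the summands cyclically, the last one
  returning to \<open>x\<close> since \<open>x ^ q ^ n = x\<close>.\<close>

lemma Tr_frobenius: "Tr q n (x ^ q :: 'a) = Tr q n x"
proof -
  obtain m where m: "n = Suc m" using n_pos by (cases n) auto
  have "Tr q n (x ^ q) = (\<Sum>i<n. x ^ q ^ Suc i)"
    by (simp add: Tr_def flip: power_mult)
  also have "\<dots> = (\<Sum>i<m. x ^ q ^ Suc i) + x"
    using power_card_field[of x] m by simp
  also have "\<dots> = (\<Sum>i<Suc m. x ^ q ^ i)"
    by (subst sum.lessThan_Suc_shift) simp
  finally show ?thesis by (simp add: Tr_def m)
qed

lemma Tr_in_GF: "Tr q n (x :: 'a) \<in> K"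
proof -
  have "(\<Sum>i\<in>A. x ^ q ^ i) ^ q = (\<Sum>i\<in>A. (x ^ q) ^ q ^ i)" for A
  proof (induction A rule: infinite_finite_induct)
    case (insert i A)
    then show ?case using frobenius_add[of _ _ 1]
      by (simp add: mult.commute flip: power_mult)
  qed (use q_gt_1 in auto)
  then have "Tr q n x ^ q = Tr q n (x ^ q)" by (simp add: Tr_def)
  then show ?thesis by (simp add: GF_def Tr_frobenius)
qed

text \<open>As a polynomial the trace has degree at most \<open>q ^ (n - 1)\<close>, and it is
  nonzero because the coefficient of x is 1.\<close>

lemma card_Tr_kernel_le: "card {x :: 'a. Tr q n x = 0} \<le> q ^ (n - 1)"
proof -
  define P :: "'a poly" where "P = Tr q n [:0, 1:]"
  have "coeff P 1 = (\<Sum>i<n. if i = 0 then 1 else 0)"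
    unfolding P_def Tr_linear_poly coeff_sum
    using q_gt_1 by (intro sum.cong) auto
  also have "\<dots> = 1" using n_pos by simp
  finally have "P \<noteq> 0" by auto
  then have "card {x. poly P x = 0} \<le> degree P" by (rule card_poly_roots_bound)
  also have "degree P \<le> q ^ (n - 1)"
    unfolding P_def Tr_linear_poly using q_gt_1
    by (intro degree_sum_le order.trans[OF degree_monom_le] power_increasing) auto
  also have "{x. poly P x = 0} = {x. Tr q n x = 0}" by (simp add: P_def poly_Tr_linear)
  finally show ?thesis .
qed

text \<open>The map \<open>x \<mapsto> x\<^sup>q - x\<close> has kernel \<open>K\<close> and takes values in the kernel of the trace, which has
  at most \<open>q\<^bsup>n-1\<^esup>\<close> elements.\<close>

lemma card_GF: "card K = q"
proof (rule antisym)
  show "card K \<le> q" using card_GF_le q_gt_1 .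
  have "x ^ q - x = y ^ q - y \<longleftrightarrow> x - y \<in> K" for x y :: 'a
  proof -
    have "(x - y) ^ q = x ^ q - y ^ q" using frobenius_diff[of x y 1] by simp
    then show ?thesis by (simp add: GF_def) (auto simp: algebra_simps)
  qed
  then have "q ^ n = card K * card (range (\<lambda>x :: 'a. x ^ q - x))"
    unfolding card_field[symmetric] by (rule card_eq_card_fiber_mult_card_range)
  also have "card (range (\<lambda>x :: 'a. x ^ q - x)) \<le> card {x :: 'a. Tr q n x = 0}"
    by (intro card_mono) (auto simp: Tr_diff Tr_frobenius)
  also note card_Tr_kernel_le
  finally have "q ^ n \<le> card K * q ^ (n - 1)" by simp
  moreover have "q ^ n = q * q ^ (n - 1)" using n_pos by (cases n) auto
  ultimately show "q \<le> card K" using q_gt_1 by simp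
qed

lemma Tr_nondegenerate:
  assumes "\<And>x :: 'a. Tr q n (y * x) = 0"
  shows "y = 0"
proof (rule ccontr)
  assume y: "y \<noteq> 0"
  have "Tr q n x = 0" for x :: 'a
    using assms[of "x / y"] y by simp
  then have "q ^ n \<le> q ^ (n - 1)"
    using card_Tr_kernel_le card_field by simp
  then show False using q_gt_1 n_pos by simp
qed

section \<open>Duality: functionals and orthogonal complements through the trace form\<close>

lemma subspace_over_Tr_kernel: "subspace_over K times {x. Tr q n (y * x) = 0}"
  unfolding subspace_over_def
  by (auto simp: distrib_left Tr_add Tr_0 Tr_scale mult.left_commute[of y])

text \<open>Extend \<open>B\<close> to a basis \<open>B'\<close> of the field. Sending
  \<open>y\<close> to its trace values on \<open>B'\<close> is injective by nondegeneracy, and both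
  sides have \<open>q ^ n\<close> elements, so all value families occur.\<close>

lemma trace_dual_exists:
  assumes B: "independent_over K times B" and h: "\<forall>v\<in>B. h v \<in> K"
  shows "\<exists>y. \<forall>v\<in>B. Tr q n (y * v) = h v"
proof -
  have UNIV: "subspace_over K times UNIV" by (simp add: subspace_over_def)
  obtain B' where B': "B \<subseteq> B'" "independent_over K times B'" "span_over K times B' = UNIV"
    using K.independent_over_extend_basis[OF UNIV finite B] by auto
  define T where "T y = (\<lambda>v\<in>B'. Tr q n (y * v))" for y
  have "inj T"
  proof (rule injI)
    fix y z assume eq: "T y = T z"
    have 0: "Tr q n ((y - z) * v) = 0" if "v \<in> B'" for v
      using that fun_cong[OF eq, of v] by (simp add: T_def left_diff_distrib Tr_diff)
    have "span_over K times B' \<subseteq> {v. Tr q n ((y - z) * v) = 0}"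
      using 0 by (intro K.span_over_minimal subspace_over_Tr_kernel) blast
    then have "Tr q n ((y - z) * v) = 0" for v using B'(3) by blast
    then have "y - z = 0" by (rule Tr_nondegenerate)
    then show "y = z" by simp
  qed
  then have "card (range T) = q ^ n" by (simp add: card_image card_field)
  moreover have "card (B' \<rightarrow>\<^sub>E K) = q ^ n"
    using K.card_span_independent[OF B'(2)] B'(3) card_field by (simp add: card_PiE)
  moreover have "range T \<subseteq> B' \<rightarrow>\<^sub>E K" by (auto simp: T_def Tr_in_GF)
  ultimately have "range T = B' \<rightarrow>\<^sub>E K" by (intro card_subset_eq) (auto intro!: finite_PiE)
  moreover have "(\<lambda>v\<in>B'. if v \<in> B then h v else 0) \<in> B' \<rightarrow>\<^sub>E K"
    using h K.F_intros(1) by auto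
  ultimately obtain y where y: "T y = (\<lambda>v\<in>B'. if v \<in> B then h v else 0)" by (metis imageE)
  have "Tr q n (y * v) = h v" if "v \<in> B" for v
    using fun_cong[OF y, of v] that B'(1) by (auto simp: T_def)
  then show ?thesis by blast
qed

text \<open>The complement is the kernel of the map to trace values on \<open>B\<close>, which is
  onto \<open>B \<rightarrow>\<^sub>E K\<close> by \<open>trace_dual_exists\<close>.\<close>

lemma card_perp_independent:
  assumes B: "independent_over K times B"
  shows "card {y. \<forall>v\<in>B. Tr q n (y * v) = 0} * q ^ card B = q ^ n"
proof -
  define T where "T y = (\<lambda>v\<in>B. Tr q n (y * v))" for y
  have "T y = T z \<longleftrightarrow> y - z \<in> {y. \<forall>v\<in>B. Tr q n (y * v) = 0}" for y z
    by (auto simp: T_def fun_eq_iff left_diff_distrib Tr_diff restrict_def)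
  then have "q ^ n = card {y. \<forall>v\<in>B. Tr q n (y * v) = 0} * card (range T)"
    unfolding card_field[symmetric] by (rule card_eq_card_fiber_mult_card_range)
  moreover have "range T = B \<rightarrow>\<^sub>E K"
  proof
    show "range T \<subseteq> B \<rightarrow>\<^sub>E K" by (auto simp: T_def Tr_in_GF)
    show "B \<rightarrow>\<^sub>E K \<subseteq> range T"
    proof
      fix h assume h: "h \<in> B \<rightarrow>\<^sub>E K"
      then obtain y where "\<forall>v\<in>B. Tr q n (y * v) = h v"
        using trace_dual_exists[OF B, of h] by auto
      then have "h = T y" using h by (auto simp: T_def fun_eq_iff PiE_def extensional_def)
      then show "h \<in> range T" by blast
    qed
  qed
  ultimately show ?thesis by (simp add: card_PiE card_GF)
qed

text \<open>Match the values on a basis of \<open>V\<close> and extend by linearity. The functional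
  need only be linear on \<open>V\<close>, which allows functionals defined on the span of a few
  elements.\<close>

lemma functional_eq_Tr:
  assumes V: "subspace_over K times V"
    and add: "\<And>u v. u \<in> V \<Longrightarrow> v \<in> V \<Longrightarrow> l (u + v) = l u + l v"
    and scale: "\<And>a v. a \<in> K \<Longrightarrow> v \<in> V \<Longrightarrow> l (a * v) = a * l v"
    and ran: "\<And>v. v \<in> V \<Longrightarrow> l v \<in> K"
  shows "\<exists>y. \<forall>v\<in>V. Tr q n (y * v) = l v"
proof -
  obtain B where B: "B \<subseteq> V" "independent_over K times B" "span_over K times B = V"
    using K.obtain_basis[OF V finite] .
  then obtain y where y: "\<forall>v\<in>B. Tr q n (y * v) = l v"
    using trace_dual_exists[OF B(2), of l] ran by blast
  have "subspace_over K times {v \<in> V. Tr q n (y * v) = l v}"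
  proof -
    have "l 0 = 0" using scale[of 0 0] V K.F_intros(1) by (simp add: subspace_over_def)
    then show ?thesis using V unfolding subspace_over_def
      by (auto simp: distrib_left Tr_add Tr_0 Tr_scale add scale mult.left_commute[of y])
  qed
  then have "V \<subseteq> {v \<in> V. Tr q n (y * v) = l v}"
    unfolding B(3)[symmetric] using y B by (intro K.span_over_minimal) auto
  then show ?thesis by blast
qed

section \<open>The field K(b) and its basis of powers of \<open>b\<close>\<close>

lemma subspace_over_subfield: "is_subfield L \<Longrightarrow> K \<subseteq> L \<Longrightarrow> subspace_over K times L"
  unfolding subspace_over_def by (auto intro: is_subfield_0 is_subfield_add is_subfield_mult)

text \<open>By finiteness the inverse of a nonzero x is its power with exponent
  \<open>q ^ n - 2\<close>, so closure under products suffices.\<close>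

lemma subring_imp_subfield:
  assumes A: "subspace_over K times A" and 1: "1 \<in> A"
    and mult: "\<And>x y. x \<in> A \<Longrightarrow> y \<in> A \<Longrightarrow> x * y \<in> A"
  shows "is_subfield A"
proof -
  have pow: "x ^ k \<in> A" if "x \<in> A" for x k
    by (induction k) (use that 1 mult in auto)
  have "inverse x \<in> A" if x: "x \<in> A" for x
  proof (cases "x = 0")
    case False
    have "q ^ n > 1" using q_gt_1 n_pos by (rule one_less_power)
    then obtain k where k: "q ^ n = Suc (Suc k)" by (metis One_nat_def less_natE add_Suc_right add_Suc)
    then have "x * x ^ k = 1" using power_card_field[of x] False by simp
    then have "inverse x = x ^ k" by (metis inverse_unique)
    then show ?thesis using pow[OF x] by simp
  qed (use x in simp)
  then show ?thesis
    unfolding is_subfield_def using A 1 mult K.subspace_over_diff[OF A]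
    by (auto simp: subspace_over_def)
qed

text \<open>Take the least \<open>s\<close> with \<open>b ^ s\<close> in the span of the lower
  powers. That span is closed under products, hence a field, hence K(b). Comparing cardinalities
  then identifies \<open>s\<close> with \<open>t\<close>, which is defined through an arbitrary
  basis.\<close>

lemma adjoin_power_basis:
  fixes b :: 'a
  defines "L \<equiv> adjoin K b"
  defines "t \<equiv> ext_degree L K"
  shows "independent_over K times ((^) b ` {..<t})"
    and "inj_on ((^) b) {..<t}"
    and "span_over K times ((^) b ` {..<t}) = L"
    and card_adjoin: "card L = q ^ t"
proof -
  let ?A = "\<lambda>s. span_over K times ((^) b ` {..<s})"
  \<comment> \<open>Otherwise all powers of \<open>b\<close> would be distinct in a finite
    field.\<close>
  have "\<exists>s. b ^ s \<in> ?A s"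
  proof (rule ccontr)
    assume no: "\<not> ?thesis"
    have "b ^ i \<noteq> b ^ j" if "i < j" for i j
      using no K.span_over_superset[of "(^) b ` {..<j}"] that by (metis imageI lessThan_iff subsetD)
    then have "inj ((^) b)" by (intro linorder_injI) auto
    then show False using finite_imageD[of "(^) b" UNIV] by auto
  qed
  then obtain s where s: "b ^ s \<in> ?A s" "\<And>j. j < s \<Longrightarrow> b ^ j \<notin> ?A j"
    by (metis exists_least_iff[of "\<lambda>s. b ^ s \<in> ?A s"])
  have ind: "independent_over K times ((^) b ` {..<j})" if "j \<le> s" for j
    using that
  proof (induction j)
    case 0
    then show ?case by (simp add: K.independent_over_empty)
  next
    case (Suc j)
    then show ?case using K.independent_over_insert[of "(^) b ` {..<j}" "b ^ j"] s(2)
      by (simp add: lessThan_Suc)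
  qed
  have inj: "inj_on ((^) b) {..<s}"
  proof (rule linorder_inj_onI)
    fix i j assume "i < j" "i \<in> {..<s}" "j \<in> {..<s}"
    then show "b ^ i \<noteq> b ^ j"
      using s(2)[of j] K.span_over_superset[of "(^) b ` {..<j}"] by (metis imageI lessThan_iff subsetD)
  qed auto
  have sub: "subspace_over K times (?A s)" by (intro K.subspace_over_span) auto
  have "s \<noteq> 0"
  proof
    assume "s = 0"
    then show False using s(1) K.span_over_finite[of "{}"] by simp
  qed
  then have 1: "1 \<in> ?A s" using K.span_over_superset[of "(^) b ` {..<s}"]
    by (metis image_eqI lessThan_iff power_0 subsetD not_gr_zero)
  \<comment> \<open>On generators only the exponent \<open>i = s - 1\<close> leaves the list, and
    there the choice of \<open>s\<close> applies.\<close>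
  have b: "b * x \<in> ?A s" if "x \<in> ?A s" for x
  proof -
    have "b * b ^ i \<in> ?A s" if "i < s" for i
      using that s(1) K.span_over_superset[of "(^) b ` {..<s}"]
      by (cases "Suc i = s") (auto simp flip: power_Suc)
    moreover have "subspace_over K times {x. b * x \<in> ?A s}"
      using sub by (auto simp: subspace_over_def distrib_left mult.left_commute[of b])
    ultimately have "?A s \<subseteq> {x. b * x \<in> ?A s}"
      by (intro K.span_over_minimal) auto
    then show ?thesis using that by auto
  qed
  have mult: "x * y \<in> ?A s" if "x \<in> ?A s" "y \<in> ?A s" for x y
  proof -
    have "b ^ i * y \<in> ?A s" for i
      by (induction i) (use that b in \<open>auto simp: mult.assoc\<close>)
    moreover have "subspace_over K times {x. x * y \<in> ?A s}"
      using sub by (auto simp: subspace_over_def distrib_right mult.assoc)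
    ultimately have "?A s \<subseteq> {x. x * y \<in> ?A s}"
      by (intro K.span_over_minimal) auto
    then show ?thesis using that by auto
  qed
  have "is_subfield (?A s)" using subring_imp_subfield[OF sub 1 mult] .
  moreover have "K \<subseteq> ?A s"
  proof
    fix a assume "a \<in> K"
    then have "a * 1 \<in> ?A s" using sub 1 unfolding subspace_over_def by blast
    then show "a \<in> ?A s" by simp
  qed
  moreover have "b \<in> ?A s" using b[OF 1] by simp
  ultimately have "L \<subseteq> ?A s" unfolding L_def adjoin_def by blast
  moreover have L: "is_subfield L" "K \<subseteq> L" "b \<in> L"
    unfolding L_def by (simp_all add: is_subfield_adjoin adjoin_superset adjoin_gen)
  moreover have "?A s \<subseteq> L"
    using L by (intro K.span_over_minimal subspace_over_subfield) (auto intro: is_subfield_power)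
  ultimately have span: "?A s = L" by auto
  have card: "card L = q ^ s"
    using K.card_span_independent[OF ind[OF order.refl]] inj span by (simp add: card_image card_GF)
  moreover have "card L = q ^ t"
    using K.card_eq_power_dim[OF subspace_over_subfield[OF L(1,2)]] by (simp add: card_GF t_def ext_degree_def)
  ultimately have "s = t" using q_gt_1 by simp
  then show "independent_over K times ((^) b ` {..<t})" "inj_on ((^) b) {..<t}" "?A t = L"
    "card L = q ^ t"
    using ind inj span card by auto
qed

text \<open>K(b) has \<open>q ^ t\<close> elements, all fixed by the power \<open>q ^ t\<close>, and
  there are at most that many fixed elements. The elements 0 and 1 give \<open>q ^ t > 1\<close>, as
  the bound requires.\<close>

lemma GF_power_eq_adjoin:
  fixes b :: 'a
  defines "t \<equiv> ext_degree (adjoin K b) K"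
  shows "GF (q ^ t) = adjoin K b"
proof -
  have card: "card (adjoin K b) = q ^ t" unfolding t_def by (rule card_adjoin)
  have "(0::'a) \<noteq> 1" "{0,1} \<subseteq> adjoin K b"
    using is_subfield_0 is_subfield_1 is_subfield_adjoin by auto
  then have "card {0, 1 :: 'a} \<le> card (adjoin K b)" by (intro card_mono) auto
  then have "q ^ t > 1" by (simp add: card)
  moreover have "adjoin K b \<subseteq> GF (q ^ t)"
    using is_subfield_power_card[OF is_subfield_adjoin, of _ K b, unfolded card]
    unfolding GF_def[of "q ^ t"] by blast
  ultimately have "adjoin K b = GF (q ^ t)"
    using card_GF_le[of "q ^ t", where ?'a = 'a] card by (intro card_seteq) auto
  then show ?thesis by simp
qed

end

section \<open>Equivalence of polynomials\<close>

text \<open>The map (x, y, z) -> (x, (y - m x)/a, z) carries one graph to the other. It is linear,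
  so its companion automorphism is the identity; \<open>\<psi>\<close> is its inverse.\<close>

lemma poly_equivalent_affine:
  fixes f g :: "'a::field poly"
  assumes fg: "f \<in> q_polys q" "g \<in> q_polys q" and a: "a \<noteq> 0"
    and eq: "\<And>x. poly f x = m * x + a * poly g x"
  shows "poly_equivalent q f g"
proof -
  define \<phi> :: "'a^3 \<Rightarrow> 'a^3" where "\<phi> v = vector [v$1, (v$2 - m * v$1) / a, v$3]" for v
  define \<psi> :: "'a^3 \<Rightarrow> 'a^3" where "\<psi> v = vector [v$1, m * v$1 + a * v$2, v$3]" for v
  have "bij \<phi>"
    by (rule o_bij[of \<psi>])
      (use a in \<open>auto simp: \<phi>_def \<psi>_def fun_eq_iff vec_eq_iff forall_3\<close>)
  moreover have "\<phi> (u + v) = \<phi> u + \<phi> v" for u v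
    by (simp add: \<phi>_def vec_eq_iff forall_3 field_simps a)
  moreover have scale: "\<phi> (k *s v) = k *s \<phi> v" for k v
    using a by (simp add: \<phi>_def vec_eq_iff forall_3 field_simps)
  moreover have "field_automorphism (\<lambda>x :: 'a. x)" by (simp add: field_automorphism_def bij_def)
  ultimately have "\<phi> \<in> GammaL3" unfolding GammaL3_def by blast
  moreover have "\<phi> ` vec.span {v} = vec.span {\<phi> v}" for v
    by (simp add: vec.span_singleton image_image scale)
  moreover have "\<phi> (vector [x, poly f x, 1]) = vector [x, poly g x, 1]" for x
    using a by (simp add: \<phi>_def eq)
  ultimately have "(\<lambda>P. \<phi> ` P) ` graph_points f = graph_points g"
    unfolding graph_points_def by (simp add: full_SetCompr_eq image_image)
  then show ?thesis using fg \<open>\<phi> \<in> GammaL3\<close> unfolding poly_equivalent_def by blast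
qed

lemma Tr_combination_in_q_polys: "Tr q n [:0, \<xi>:] + smult b (Tr q n [:0, \<eta>:]) \<in> q_polys q"
proof -
  have "Tr q n [:0, \<xi>:] + smult b (Tr q n [:0, \<eta>:]) =
      (\<Sum>i<n. monom (\<xi> ^ q ^ i + b * \<eta> ^ q ^ i) (q ^ i))"
    by (rule poly_eqI)
      (simp add: Tr_linear_poly coeff_sum sum_distrib_left flip: sum.distrib, rule sum.cong, auto)
  then show ?thesis unfolding q_polys_def
    by (intro CollectI exI[of _ n] exI[of _ "\<lambda>i. \<xi> ^ q ^ i + b * \<eta> ^ q ^ i"]) simp
qed

context finite_field_extension
begin

section \<open>Club polynomials\<close>

lemma poly_q_poly_add: "f \<in> q_polys q \<Longrightarrow> poly f (x + y :: 'a) = poly f x + poly f y"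
  by (auto simp: q_polys_def poly_sum poly_monom frobenius_add distrib_left sum.distrib)

lemma poly_q_poly_scale: "f \<in> q_polys q \<Longrightarrow> a \<in> K \<Longrightarrow> poly f (a * x) = a * poly f x"
  by (auto simp: q_polys_def poly_sum poly_monom frobenius_fixed power_mult_distrib
      sum_distrib_left mult.left_commute)

lemma poly_q_poly_0: "f \<in> q_polys q \<Longrightarrow> poly f (0 :: 'a) = 0"
  using poly_q_poly_scale[of f 0 0] K.F_intros(1) by simp

text \<open>The injective \<open>K\<close>-linear map x -> (x, f(x)) takes the solutions of f(x) = m
  x onto the part of \<open>U_set f\<close> in the point of slope \<open>m\<close>. This turns
  weights into numbers of solutions.\<close>

lemma card_eigenspace_eq_weight:
  assumes f: "f \<in> q_polys q" and x0: "x0 \<noteq> (0 :: 'a)" "poly f x0 = m * x0"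
  defines "P \<equiv> vec.span {vector [x0, poly f x0] :: 'a^2}"
  shows "P \<in> L_set f" "card {x. poly f x = m * x} = q ^ weight q f P"
    "\<And>x. vector [x, poly f x] \<in> P \<Longrightarrow> poly f x = m * x"
proof -
  let ?v = "\<lambda>x. vector [x, poly f x] :: 'a^2"
  interpret V: subfield_space "vector_scalar_mult :: 'a \<Rightarrow> 'a^2 \<Rightarrow> 'a^2" K
    by (intro subfield_space.intro subfield_space_axioms.intro vec.vector_space_axioms is_subfield_GF)
  have v_in: "?v x \<in> P \<longleftrightarrow> poly f x = m * x" for x
  proof
    assume "?v x \<in> P"
    then obtain k where "?v x = k *s ?v x0" unfolding P_def vec.span_singleton by auto
    then have "x = k * x0" "poly f x = k * (m * x0)" by (auto simp: vec_eq_iff forall_2 x0(2))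
    then show "poly f x = m * x" by (metis mult.left_commute)
  next
    assume "poly f x = m * x"
    then have "?v x = (x / x0) *s ?v x0" using x0 by (simp add: vec_eq_iff forall_2)
    then show "?v x \<in> P" unfolding P_def vec.span_singleton by blast
  qed
  then show "\<And>x. ?v x \<in> P \<Longrightarrow> poly f x = m * x" by blast
  have "?v x0 \<noteq> 0" using x0 by (auto simp: vec_eq_iff forall_2)
  then show "P \<in> L_set f" unfolding L_set_def U_set_def P_def by blast
  have eq: "U_set f \<inter> P = ?v ` {x. poly f x = m * x}"
    using v_in unfolding U_set_def by blast
  have add: "?v x + ?v y = ?v (x + y)" and scale: "a \<in> K \<Longrightarrow> a *s ?v x = ?v (a * x)"
    and zero: "0 = ?v 0" for x y a
    by (simp_all add: vec_eq_iff forall_2 f poly_q_poly_add poly_q_poly_scale poly_q_poly_0)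
  have "subspace_over K vector_scalar_mult (U_set f \<inter> P)"
    unfolding eq subspace_over_def
  proof (intro conjI ballI)
    show "0 \<in> ?v ` {x. poly f x = m * x}"
      unfolding zero using poly_q_poly_0[OF f] by (intro imageI) simp
    show "u + v \<in> ?v ` {x. poly f x = m * x}"
      if uv: "u \<in> ?v ` {x. poly f x = m * x}" "v \<in> ?v ` {x. poly f x = m * x}" for u v
    proof -
      obtain x y where xy: "u = ?v x" "v = ?v y" "poly f x = m * x" "poly f y = m * y"
        using uv by blast
      then show ?thesis unfolding xy(1,2) add
        by (intro imageI CollectI) (simp add: poly_q_poly_add[OF f] distrib_left)
    qed
    show "a *s v \<in> ?v ` {x. poly f x = m * x}"
      if a: "a \<in> K" and v: "v \<in> ?v ` {x. poly f x = m * x}" for a v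
    proof -
      obtain x where x: "v = ?v x" "poly f x = m * x" using v by blast
      then show ?thesis unfolding x(1) scale[OF a]
        by (intro imageI CollectI) (simp add: poly_q_poly_scale[OF f a])
    qed
  qed
  then have "card (U_set f \<inter> P) = q ^ weight q f P"
    using V.card_eq_power_dim card_GF unfolding weight_def by auto
  moreover have "inj ?v" by (rule injI) (auto simp: vec_eq_iff forall_2)
  ultimately show "card {x. poly f x = m * x} = q ^ weight q f P"
    unfolding eq by (metis card_image inj_on_subset subset_UNIV)
qed

text \<open>The slope \<open>m0\<close> belongs to the heavy point. Another slope either belongs to
  a different point, of weight 1, or has 0 as its only solution.\<close>

lemma club_poly_eigenspaces:
  fixes f :: "'a poly"
  assumes f: "f \<in> q_polys q" and club: "club_poly q i f"
  obtains m0 where "card {x. poly f x = m0 * x} = q ^ i"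
    "\<And>m. m \<noteq> m0 \<Longrightarrow> card {x. poly f x = m * x} \<le> q"
proof -
  have ex1: "\<exists>!P. P \<in> L_set f \<and> weight q f P = i"
    and other: "\<forall>P\<in>L_set f. weight q f P \<noteq> i \<longrightarrow> weight q f P = 1"
    using club unfolding club_poly_def by (rule conjunct1, rule conjunct2)
  then obtain P where P: "P \<in> L_set f" "weight q f P = i"
    and uniq: "\<forall>P'. P' \<in> L_set f \<and> weight q f P' = i \<longrightarrow> P' = P"
    unfolding Ex1_def by blast
  obtain x0 where x0: "P = vec.span {vector [x0, poly f x0]}" "vector [x0, poly f x0] \<noteq> (0 :: 'a^2)"
    using P(1) unfolding L_set_def U_set_def by blast
  \<comment> \<open>Since f(0) = 0, a nonzero vector of \<open>U_set f\<close> has nonzero first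
    coordinate, so every point has a slope.\<close>
  have "x0 \<noteq> 0" using x0(2) poly_q_poly_0[OF f] by (auto simp: vec_eq_iff forall_2)
  define m0 where "m0 = poly f x0 / x0"
  have m0: "poly f x0 = m0 * x0" using \<open>x0 \<noteq> 0\<close> by (simp add: m0_def)
  note W = card_eigenspace_eq_weight[OF f \<open>x0 \<noteq> 0\<close> m0, folded x0(1)]
  show ?thesis
  proof
    show "card {x. poly f x = m0 * x} = q ^ i" using W(2) P(2) by simp
    fix m assume m: "m \<noteq> m0"
    show "card {x. poly f x = m * x} \<le> q"
    proof (cases "\<exists>x1. x1 \<noteq> 0 \<and> poly f x1 = m * x1")
      case True
      then obtain x1 where x1: "x1 \<noteq> 0" "poly f x1 = m * x1" by blast
      let ?P = "vec.span {vector [x1, poly f x1] :: 'a^2}"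
      note W' = card_eigenspace_eq_weight[OF f x1]
      have "?P \<noteq> P"
      proof
        assume "?P = P"
        then have "vector [x1, poly f x1] \<in> P" using vec.span_base by blast
        then have "poly f x1 = m0 * x1" by (rule W(3))
        then show False using x1 m by simp
      qed
      then have "weight q f ?P = 1" using W'(1) uniq other by metis
      then show ?thesis using W'(2) by simp
    next
      case False
      then have "{x. poly f x = m * x} \<subseteq> {0}" by auto
      then have "card {x. poly f x = m * x} \<le> card {0 :: 'a}" by (intro card_mono) auto
      then show ?thesis using q_gt_1 by simp
    qed
  qed
qed

section \<open>Maps of rank two, and \<open>K\<close>-linear relations between their trace
  coefficients\<close>

lemma coordinates_unique:
  assumes b: "b \<notin> K" and K: "x \<in> K" "y \<in> K" "x' \<in> K" "y' \<in> K" and eq: "x + b * y = x' + b * y'"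
  shows "x = x'" "y = y'"
proof -
  show "y = y'"
  proof (rule ccontr)
    assume "y \<noteq> y'"
    then have "b = (x' - x) / (y - y')" using eq by (simp add: field_simps)
    then show False using b K K.F_intros by simp
  qed
  then show "x = x'" using eq by simp
qed

text \<open>The image has \<open>q ^ 2\<close> elements, hence a basis \<open>{a, v}\<close>. With
  \<open>b = v / a\<close>, the coordinates of \<open>g x / a\<close> with respect to
  \<open>1, b\<close> are \<open>K\<close>-linear functionals of \<open>x\<close>, that is,
  traces.\<close>

lemma rank_two_map_eq_Tr:
  fixes g :: "'a \<Rightarrow> 'a"
  assumes add: "\<And>x y. g (x + y) = g x + g y" and scale: "\<And>a x. a \<in> K \<Longrightarrow> g (a * x) = a * g x"
    and ker: "card {x. g x = 0} = q ^ (n - 2)" and n: "n \<ge> 2"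
  obtains a b \<xi> \<eta> where "a \<noteq> 0" "b \<notin> K" "\<xi> \<noteq> 0" "\<eta> \<noteq> 0"
    "\<And>x. g x = a * (Tr q n (\<xi> * x) + b * Tr q n (\<eta> * x))"
proof -
  have g0: "g 0 = 0" using scale[of 0 0] K.F_intros(1) by simp
  have diff: "g (x - y) = g x - g y" for x y using add[of "x - y" y] by simp
  have "q ^ n = card {x. g x = 0} * card (range g)"
    unfolding card_field[symmetric] by (rule card_eq_card_fiber_mult_card_range) (simp add: diff)
  also have "q ^ n = q ^ (n - 2) * q ^ 2" using n by (metis le_add_diff_inverse2 power_add)
  finally have card: "card (range g) = q ^ 2" using ker q_gt_1 by simp
  have sub: "subspace_over K times (range g)"
    unfolding subspace_over_def using g0 by (auto simp flip: add scale intro: range_eqI[of _ _ 0])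
  obtain B where B: "B \<subseteq> range g" "independent_over K times B" "span_over K times B = range g"
    using K.obtain_basis[OF sub finite] .
  have "q ^ card B = q ^ 2" using K.card_span_independent[OF B(2)] B(3) card card_GF by simp
  then have "card B = 2" using q_gt_1 by simp
  then obtain a v where av: "B = {a, v}" "a \<noteq> v" by (meson card_2_iff)
  have ind: "x = 0 \<and> y = 0" if "x \<in> K" "y \<in> K" "x * a + y * v = 0" for x y
  proof -
    have "\<forall>u\<in>{a, v}. (if u = a then x else y) = 0"
      using B(2)[unfolded independent_over_def, THEN spec, THEN spec,
          of "{a, v}" "\<lambda>u. if u = a then x else y"] av that by auto
    then show ?thesis using av(2) by auto
  qed
  have a: "a \<noteq> 0" using ind[of 1 0] K.F_intros by auto
  define b where "b = v / a"
  have v: "v = a * b" using a by (simp add: b_def)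
  have b: "b \<notin> K"
  proof
    assume "b \<in> K"
    then show False using ind[of "- b" 1] K.F_intros v by (simp add: mult.commute)
  qed
  have "\<exists>x1\<in>K. \<exists>x2\<in>K. g x = a * (x1 + b * x2)" for x
  proof -
    have "g x \<in> span_over K times {a, v}" using B(3) av by auto
    then obtain r where "g x = (\<Sum>u\<in>{a, v}. r u * u)" "\<forall>u\<in>{a, v}. r u \<in> K"
      by (subst (asm) K.span_over_finite) auto
    then show ?thesis using av(2) by (intro bexI[of _ "r a"] bexI[of _ "r v"])
        (auto simp: v algebra_simps)
  qed
  then obtain l1 l2 where l: "\<And>x. l1 x \<in> K" "\<And>x. l2 x \<in> K" "\<And>x. g x = a * (l1 x + b * l2 x)"
    by metis
  \<comment> \<open>Uniqueness of the coordinates is what makes the chosen functions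
    \<open>l1\<close> and \<open>l2\<close> linear over \<open>K\<close>.\<close>
  have u: "l1 x = x1 \<and> l2 x = x2" if "x1 \<in> K" "x2 \<in> K" "g x = a * (x1 + b * x2)" for x x1 x2
    using coordinates_unique[OF b l(1,2), of x1 x2 x x] l(3)[of x] that a by auto
  have add': "l1 (x + y) = l1 x + l1 y \<and> l2 (x + y) = l2 x + l2 y" for x y
    by (rule u) (use l(1,2) K.F_intros(6) in \<open>auto simp: add[of x y] l(3)[of x] l(3)[of y] algebra_simps\<close>)
  have scale': "l1 (k * x) = k * l1 x \<and> l2 (k * x) = k * l2 x" if "k \<in> K" for k x
    by (rule u) (use l(1,2) K.F_intros(4) that in \<open>auto simp: scale l(3)[of x] algebra_simps\<close>)
  have UNIV: "subspace_over K times UNIV" by (simp add: subspace_over_def)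
  obtain \<xi> where \<xi>: "\<And>x. Tr q n (\<xi> * x) = l1 x"
    using functional_eq_Tr[OF UNIV, of l1] add' scale' l by blast
  obtain \<eta> where \<eta>: "\<And>x. Tr q n (\<eta> * x) = l2 x"
    using functional_eq_Tr[OF UNIV, of l2] add' scale' l by blast
  \<comment> \<open>Both basis vectors \<open>a\<close> and \<open>a * b\<close> are values of
    \<open>g\<close>, so neither coordinate functional vanishes.\<close>
  obtain xa xv where x: "g xa = a" "g xv = a * b" using B(1) av v by (metis imageE insert_subset)
  have "\<xi> \<noteq> 0"
    using u[of 1 0 xa] x(1) K.F_intros \<xi>[of xa] by (auto simp: Tr_0)
  moreover have "\<eta> \<noteq> 0"
    using u[of 0 1 xv] x(2) K.F_intros \<eta>[of xv] by (auto simp: Tr_0)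
  ultimately show ?thesis using that[OF a b, of \<xi> \<eta>] l(3) \<xi> \<eta> by simp
qed

text \<open>If every \<open>K\<close>-linear relation between \<open>\<xi>, \<eta>, \<xi>b, \<eta>b\<close> satisfied \<open>\<alpha> + \<delta> = 0\<close>, then
  \<open>\<alpha>\<xi> + \<beta>\<eta> + \<gamma>\<xi>b + \<delta>\<eta>b \<mapsto> \<alpha> + \<delta>\<close> would be a well-defined functional, hence of the form
  \<open>y \<mapsto> Tr(\<lambda>y)\<close>.\<close>

lemma relation_from_unsolvable_system:
  fixes \<xi> \<eta> b :: 'a
  assumes no: "\<And>z. \<not> (Tr q n (z * \<xi>) = 1 \<and> Tr q n (z * \<eta>) = 0 \<and>
      Tr q n (z * (\<xi> * b)) = 0 \<and> Tr q n (z * (\<eta> * b)) = 1)"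
  obtains \<alpha> \<beta> \<gamma> \<delta> where "\<alpha> \<in> K" "\<beta> \<in> K" "\<gamma> \<in> K" "\<delta> \<in> K" "\<alpha> + \<delta> \<noteq> 0"
    "\<alpha> * \<xi> + \<beta> * \<eta> + \<gamma> * (\<xi> * b) + \<delta> * (\<eta> * b) = 0"
proof (rule ccontr)
  assume "\<not> thesis"
  with that have rel: "\<alpha> + \<delta> = 0" if "\<alpha> \<in> K" "\<beta> \<in> K" "\<gamma> \<in> K" "\<delta> \<in> K"
    "\<alpha> * \<xi> + \<beta> * \<eta> + \<gamma> * (\<xi> * b) + \<delta> * (\<eta> * b) = 0" for \<alpha> \<beta> \<gamma> \<delta> using that by blast
  \<comment> \<open>\<open>R\<close> is the graph of the functional, kept as a relation until
    \<open>R_unique\<close> shows that the value does not depend on the representation of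
    \<open>y\<close>.\<close>
  define R where "R y s \<longleftrightarrow> (\<exists>\<alpha>\<in>K. \<exists>\<beta>\<in>K. \<exists>\<gamma>\<in>K. \<exists>\<delta>\<in>K.
    y = \<alpha> * \<xi> + \<beta> * \<eta> + \<gamma> * (\<xi> * b) + \<delta> * (\<eta> * b) \<and> s = \<alpha> + \<delta>)" for y s
  have R_I: "R (\<alpha> * \<xi> + \<beta> * \<eta> + \<gamma> * (\<xi> * b) + \<delta> * (\<eta> * b)) (\<alpha> + \<delta>)"
    if "\<alpha> \<in> K" "\<beta> \<in> K" "\<gamma> \<in> K" "\<delta> \<in> K" for \<alpha> \<beta> \<gamma> \<delta>
    using that unfolding R_def by blast
  have R_add: "R (y + y') (s + s')" if "R y s" "R y' s'" for y y' s s'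
  proof -
    obtain \<alpha> \<beta> \<gamma> \<delta> where 1: "\<alpha> \<in> K" "\<beta> \<in> K" "\<gamma> \<in> K" "\<delta> \<in> K"
      "y = \<alpha> * \<xi> + \<beta> * \<eta> + \<gamma> * (\<xi> * b) + \<delta> * (\<eta> * b)" "s = \<alpha> + \<delta>"
      using \<open>R y s\<close> unfolding R_def by blast
    obtain \<alpha>' \<beta>' \<gamma>' \<delta>' where 2: "\<alpha>' \<in> K" "\<beta>' \<in> K" "\<gamma>' \<in> K" "\<delta>' \<in> K"
      "y' = \<alpha>' * \<xi> + \<beta>' * \<eta> + \<gamma>' * (\<xi> * b) + \<delta>' * (\<eta> * b)" "s' = \<alpha>' + \<delta>'"
      using \<open>R y' s'\<close> unfolding R_def by blast
    have "R ((\<alpha> + \<alpha>') * \<xi> + (\<beta> + \<beta>') * \<eta> + (\<gamma> + \<gamma>') * (\<xi> * b) + (\<delta> + \<delta>') * (\<eta> * b))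
        ((\<alpha> + \<alpha>') + (\<delta> + \<delta>'))"
      by (intro R_I K.F_intros(6) 1(1-4) 2(1-4))
    then show ?thesis unfolding 1(5,6) 2(5,6) by (simp add: algebra_simps)
  qed
  have R_scale: "R (a * y) (a * s)" if "a \<in> K" "R y s" for a y s
  proof -
    obtain \<alpha> \<beta> \<gamma> \<delta> where 1: "\<alpha> \<in> K" "\<beta> \<in> K" "\<gamma> \<in> K" "\<delta> \<in> K"
      "y = \<alpha> * \<xi> + \<beta> * \<eta> + \<gamma> * (\<xi> * b) + \<delta> * (\<eta> * b)" "s = \<alpha> + \<delta>"
      using \<open>R y s\<close> unfolding R_def by blast
    have "R ((a * \<alpha>) * \<xi> + (a * \<beta>) * \<eta> + (a * \<gamma>) * (\<xi> * b) + (a * \<delta>) * (\<eta> * b))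
        (a * \<alpha> + a * \<delta>)"
      by (intro R_I K.F_intros(4) 1(1-4) that(1))
    then show ?thesis unfolding 1(5,6) by (simp add: algebra_simps)
  qed
  have R_K: "s \<in> K" if "R y s" for y s
    using that K.F_intros(6) unfolding R_def by blast
  have R_0: "s = 0" if "R 0 s" for s
    using that rel unfolding R_def by metis
  have R_unique: "s = s'" if "R y s" "R y s'" for y s s'
  proof -
    have "R (y + - 1 * y) (s + - 1 * s')"
      by (intro R_add R_scale that K.F_intros(7) K.F_intros(2))
    then show ?thesis using R_0[of "s - s'"] by simp
  qed
  define l where "l y = (SOME s. R y s)" for y
  have l: "l y = s" if "R y s" for y s
    using R_unique[OF that] someI[of "R y", OF that] unfolding l_def by metis
  have "subspace_over K times {y. \<exists>s. R y s}"
  proof -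
    have "R 0 0" using R_I[of 0 0 0 0] K.F_intros(1) by simp
    then show ?thesis using R_add R_scale unfolding subspace_over_def by blast
  qed
  then have "\<exists>z. \<forall>y\<in>{y. \<exists>s. R y s}. Tr q n (z * y) = l y"
  proof (rule functional_eq_Tr)
    show "l (u + v) = l u + l v" if uv: "u \<in> {y. \<exists>s. R y s}" "v \<in> {y. \<exists>s. R y s}" for u v
    proof -
      obtain s s' where "R u s" "R v s'" using uv by blast
      then show ?thesis using l[OF R_add, of u s v s'] l[of u s] l[of v s'] by simp
    qed
    show "l (a * v) = a * l v" if av: "a \<in> K" "v \<in> {y. \<exists>s. R y s}" for a v
    proof -
      obtain s where "R v s" using av(2) by blast
      then show ?thesis using l[OF R_scale, of a v s] l[of v s] av(1) by simp
    qed
    show "l v \<in> K" if v: "v \<in> {y. \<exists>s. R y s}" for v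
    proof -
      obtain s where "R v s" using v by blast
      then show ?thesis using l[of v s] R_K[of v s] by simp
    qed
  qed
  then obtain z where z: "\<forall>y\<in>{y. \<exists>s. R y s}. Tr q n (z * y) = l y" by blast
  have "Tr q n (z * y) = s" if "R y s" for y s
    using z that l[OF that] by auto
  then have "Tr q n (z * \<xi>) = 1" "Tr q n (z * \<eta>) = 0" "Tr q n (z * (\<xi> * b)) = 0"
    "Tr q n (z * (\<eta> * b)) = 1"
    using R_I[of 1 0 0 0] R_I[of 0 1 0 0] R_I[of 0 0 1 0] R_I[of 0 0 0 1] K.F_intros(1,2) by auto
  then show False using no by blast
qed

text \<open>The relation reads \<open>\<xi> * (\<alpha> + b * \<gamma>) + \<eta> * (\<beta> + b *
  \<delta>) = 0\<close>, which suggests \<open>d = - \<eta> / (\<alpha> + b * \<gamma>)\<close>. If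
  the denominator were 0, all four coefficients would vanish, against
  \<open>\<alpha> + \<delta> \<noteq> 0\<close>.\<close>

lemma relation_imp_common_multiple:
  fixes \<xi> \<eta> b :: 'a
  assumes K: "\<alpha> \<in> K" "\<beta> \<in> K" "\<gamma> \<in> K" "\<delta> \<in> K" and nz: "\<alpha> + \<delta> \<noteq> 0"
    and rel: "\<alpha> * \<xi> + \<beta> * \<eta> + \<gamma> * (\<xi> * b) + \<delta> * (\<eta> * b) = 0"
    and b: "b \<notin> K" and \<eta>: "\<eta> \<noteq> 0"
  obtains d where "d \<noteq> 0" "\<xi> = d * (\<beta> + b * \<delta>)" "\<eta> = d * (- \<alpha> + b * - \<gamma>)"
proof
  have nz': "\<alpha> + b * \<gamma> \<noteq> 0"
  proof
    assume 0: "\<alpha> + b * \<gamma> = 0"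
    then have "\<alpha> = 0" "\<gamma> = 0"
      using coordinates_unique[OF b K(1,3) K.F_intros(1) K.F_intros(1)] by simp_all
    then have "\<eta> * (\<beta> + b * \<delta>) = 0" using rel by (simp add: algebra_simps)
    then have "\<beta> + b * \<delta> = 0" using \<eta> by simp
    then have "\<delta> = 0" using coordinates_unique(2)[OF b K(2,4) K.F_intros(1) K.F_intros(1)] by simp
    then show False using nz \<open>\<alpha> = 0\<close> by simp
  qed
  show "- \<eta> / (\<alpha> + b * \<gamma>) \<noteq> 0" using nz' \<eta> by simp
  show "\<eta> = - \<eta> / (\<alpha> + b * \<gamma>) * (- \<alpha> + b * - \<gamma>)" using nz' by (simp add: field_simps)
  have "\<xi> * (\<alpha> + b * \<gamma>) + \<eta> * (\<beta> + b * \<delta>) = 0"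
    using rel by (simp add: algebra_simps)
  then have "\<xi> * (\<alpha> + b * \<gamma>) = - \<eta> * (\<beta> + b * \<delta>)"
    by (simp only: mult_minus_left eq_neg_iff_add_eq_0)
  then show "\<xi> = - \<eta> / (\<alpha> + b * \<gamma>) * (\<beta> + b * \<delta>)" using nz' by (simp add: field_simps)
qed

section \<open>Decomposition of the orthogonal complement of \<langle>d, db\<rangle>\<close>

lemma perp_decomposition:
  fixes b d :: 'a and W :: "'a set"
  defines "t \<equiv> ext_degree (adjoin K b) K"
  assumes b: "b \<notin> K" and d: "d \<noteq> 0"
    and W: "\<And>y. Tr q n (d * y) = 0 \<Longrightarrow> Tr q n (d * (b * y)) = 0 \<Longrightarrow> y \<in> W"
    and card_W: "card W = q ^ (n - 2)"
  obtains c S where "c \<noteq> 0" "subspace_over (GF (q ^ t)) times S"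
    "real (dim_over (GF (q ^ t)) times S) = real n / real t - 1"
    "is_direct_sum W S (times c ` span_over K times {b ^ i | i. i + 3 \<le> t})"
proof -
  let ?L = "adjoin K b"
  let ?pw = "\<lambda>s. (^) b ` {..<s}"
  have L: "is_subfield ?L" by (rule is_subfield_adjoin)
  interpret L: subfield_space times ?L by (rule subfield_space_times[OF L])
  have ind: "independent_over K times (?pw t)" and inj: "inj_on ((^) b) {..<t}"
    and span: "span_over K times (?pw t) = ?L" and card_L: "card ?L = q ^ t"
    unfolding t_def by (fact adjoin_power_basis)+
  have GF: "GF (q ^ t) = ?L" unfolding t_def by (rule GF_power_eq_adjoin)
  \<comment> \<open>As \<open>b\<close> is outside \<open>K\<close>, the degree \<open>t\<close> is
    at least 2, so the natural subtraction \<open>t - 2\<close> below is exact.\<close>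
  have "K \<subset> ?L" using adjoin_superset adjoin_gen b by blast
  then have "q ^ 1 < q ^ t" using psubset_card_mono[of ?L K] card_GF card_L by simp
  then have t: "t > 1" using q_gt_1 power_less_imp_less_exp by blast

  define S where "S = {y. \<forall>l\<in>?L. Tr q n (d * y * l) = 0}"
  have S_sub: "subspace_over ?L times S"
    unfolding subspace_over_def
  proof (intro conjI ballI)
    show "0 \<in> S" by (simp add: S_def Tr_0)
    show "u + v \<in> S" if "u \<in> S" "v \<in> S" for u v
      using that by (simp add: S_def distrib_left distrib_right Tr_add)
    fix a v assume a: "a \<in> ?L" and v: "v \<in> S"
    have "Tr q n (d * (a * v) * l) = 0" if l: "l \<in> ?L" for l
    proof -
      have "Tr q n (d * v * (a * l)) = 0"
        using v is_subfield_mult[OF L a l] unfolding S_def by blast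
      then show ?thesis by (simp add: ac_simps)
    qed
    then show "a * v \<in> S" by (simp add: S_def)
  qed
  \<comment> \<open>Up to the factor \<open>d\<close>, \<open>S\<close> is the complement of the
    power basis of K(b), so \<open>card S * q ^ t = q ^ n\<close>.\<close>
  have "bij_betw (\<lambda>y. d * y) S {z. \<forall>v\<in>?pw t. Tr q n (z * v) = 0}"
  proof -
    have "Tr q n (z * l) = 0" if z: "\<forall>v\<in>?pw t. Tr q n (z * v) = 0" and l: "l \<in> ?L" for z l
    proof -
      have "span_over K times (?pw t) \<subseteq> {l. Tr q n (z * l) = 0}"
        using z by (intro K.span_over_minimal subspace_over_Tr_kernel) blast
      then have "?L \<subseteq> {l. Tr q n (z * l) = 0}" by (simp only: span)
      then show ?thesis using l by auto
    qed
    moreover have "b ^ i \<in> ?L" for i using is_subfield_power[OF L adjoin_gen] .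
    ultimately show ?thesis
      by (intro bij_betwI[of _ _ _ "\<lambda>z. z / d"]) (use d in \<open>auto simp: S_def\<close>)
  qed
  then have "card S * q ^ t = q ^ n"
    using card_perp_independent[OF ind] inj by (simp add: bij_betw_same_card card_image)
  moreover have card_S: "card S = (q ^ t) ^ dim_over ?L times S"
    using L.card_eq_power_dim[OF S_sub] card_L by simp
  ultimately have "q ^ (t * dim_over ?L times S + t) = q ^ n"
    by (simp add: power_add power_mult)
  \<comment> \<open>In particular \<open>t\<close> divides \<open>n\<close>, and the dimension of
    \<open>S\<close> over K(b) is n/t - 1.\<close>
  then have n_eq: "n = t * dim_over ?L times S + t" using q_gt_1 by simp
  then have "real n = real t * real (dim_over ?L times S) + real t"
    by (metis of_nat_add of_nat_mult)
  then have dim: "real (dim_over ?L times S) = real n / real t - 1"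
    using t by (simp add: field_simps)

  \<comment> \<open>\<open>c0\<close> is taken dual to the top power \<open>b ^ (t - 1)\<close>: its
    trace form vanishes on all lower powers and is 1 there.\<close>
  have "\<forall>v\<in>?pw t. (if v = b ^ (t - 1) then 1 else 0) \<in> K" using K.F_intros(1,2) by simp
  then obtain c0 where c0: "\<forall>v\<in>?pw t. Tr q n (c0 * v) = (if v = b ^ (t - 1) then 1 else 0)"
    using trace_dual_exists[OF ind, of "\<lambda>v. if v = b ^ (t - 1) then 1 else 0"] by blast
  have c0_0: "Tr q n (c0 * b ^ i) = 0" if "i < t - 1" for i
  proof -
    have "i < t" using that by simp
    then have "b ^ i \<noteq> b ^ (t - 1)" using inj_onD[OF inj, of i "t - 1"] that by auto
    then show ?thesis using c0 that by auto
  qed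
  have c0_1: "Tr q n (c0 * b ^ (t - 1)) = 1" using c0 t by auto
  have c0_nz: "c0 \<noteq> 0" using c0_1 by (auto simp: Tr_0)
  define C where "C = span_over K times (?pw (t - 2))"
  have pw_eq: "{b ^ i | i. i + 3 \<le> t} = ?pw (t - 2)"
  proof -
    have "i + 3 \<le> t \<longleftrightarrow> i < t - 2" for i using t by auto
    then show ?thesis by auto
  qed
  have "independent_over K times (?pw (t - 2))"
  proof -
    have "?pw (t - 2) \<subseteq> ?pw t" by auto
    then show ?thesis using ind unfolding independent_over_def by (meson subset_trans)
  qed
  moreover have "card (?pw (t - 2)) = t - 2"
    using inj_on_subset[OF inj, of "{..<t - 2}"] by (subst card_image) auto
  ultimately have card_C: "card C = q ^ (t - 2)"
    unfolding C_def using K.card_span_independent card_GF by simp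
  have C_sub: "subspace_over K times C" unfolding C_def by (intro K.subspace_over_span) auto
  \<comment> \<open>The exponents in \<open>C\<close> are at most \<open>t - 3\<close>, so
    multiplication by \<open>b\<close> keeps them below \<open>t - 1\<close>, where
    \<open>c0\<close> is orthogonal.\<close>
  have C_perp: "Tr q n (c0 * x) = 0" "Tr q n (c0 * (b * x)) = 0" if x: "x \<in> C" for x
  proof -
    have "C \<subseteq> {x. Tr q n (c0 * x) = 0}" "C \<subseteq> {x. Tr q n (c0 * b * x) = 0}"
      unfolding C_def using c0_0[of "Suc _"]
      by (intro K.span_over_minimal subspace_over_Tr_kernel; auto simp: c0_0 mult.assoc)+
    then show "Tr q n (c0 * x) = 0" "Tr q n (c0 * (b * x)) = 0"
      using x by (auto simp: mult.assoc)
  qed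
  have "C \<subseteq> ?L"
    unfolding C_def using is_subfield_power[OF L adjoin_gen]
    by (intro K.span_over_minimal subspace_over_subfield L adjoin_superset) auto

  define c where "c = c0 / d"
  have c: "c \<noteq> 0" "\<And>x. d * (c * x) = c0 * x" using c0_nz d by (auto simp: c_def)
  \<comment> \<open>A nonzero such \<open>x\<close> lies in K(b), so \<open>b ^ (t - 1) / x\<close>
    is an admissible test element for \<open>c * x \<in> S\<close>. It yields trace 0, but the trace
    is that of \<open>c0 * b ^ (t - 1)\<close>, namely 1.\<close>
  have triv: "x = 0" if x: "x \<in> C" "c * x \<in> S" for x
  proof (rule ccontr)
    assume nz: "x \<noteq> 0"
    have "b ^ (t - 1) / x \<in> ?L"
      using x \<open>C \<subseteq> ?L\<close> is_subfield_divide[OF L is_subfield_power[OF L adjoin_gen]] by auto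
    then have "Tr q n (d * (c * x) * (b ^ (t - 1) / x)) = 0" using x(2) unfolding S_def by blast
    then show False using c0_1 nz by (simp add: c(2))
  qed
  \<comment> \<open>By \<open>triv\<close> the sums are distinct, so there are q^(n-t) q^(t-2) =
    q^(n-2) of them. They all lie in \<open>W\<close>, which has the same size, so they exhaust it
    although only one inclusion is assumed.\<close>
  let ?f = "\<lambda>(s, x). s + c * x"
  have "inj_on ?f (S \<times> C)"
  proof (rule inj_onI, clarify)
    fix s x s' x' assume *: "s \<in> S" "x \<in> C" "s' \<in> S" "x' \<in> C" "s + c * x = s' + c * x'"
    have "c * (x - x') = s' - s" using *(5) by (simp add: algebra_simps)
    then have "c * (x - x') \<in> S" using * L.subspace_over_diff[OF S_sub] by simp
    then have "x - x' = 0" using * K.subspace_over_diff[OF C_sub] triv by blast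
    then show "s = s' \<and> x = x'" using *(5) by simp
  qed
  then have "card (?f ` (S \<times> C)) = q ^ (t * dim_over ?L times S) * q ^ (t - 2)"
    by (simp add: card_image card_cartesian_product card_S card_C power_mult)
  also have "\<dots> = q ^ (n - 2)" using n_eq t by (simp flip: power_add)
  finally have "card (?f ` (S \<times> C)) = card W" using card_W by simp
  moreover have "?f ` (S \<times> C) \<subseteq> W"
  proof clarify
    fix s x assume s: "s \<in> S" and x: "x \<in> C"
    have S_perp: "Tr q n (d * s * 1) = 0" "Tr q n (d * s * b) = 0"
      using s is_subfield_1[OF L] adjoin_gen unfolding S_def by auto
    have "d * (s + c * x) = d * s * 1 + c0 * x" "d * (b * (s + c * x)) = d * s * b + c0 * (b * x)"
      unfolding c(2)[symmetric] by (simp_all add: algebra_simps)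
    then show "s + c * x \<in> W"
      by (intro W) (simp_all only: Tr_add S_perp C_perp[OF x] add_0)
  qed
  ultimately have "?f ` (S \<times> C) = W" by (intro card_subset_eq) auto
  then have "W = {s + x | s x. s \<in> S \<and> x \<in> times c ` C}" by auto
  moreover have "S \<inter> times c ` C = {0}"
  proof -
    have "0 \<in> S" "0 \<in> C" using S_sub C_sub by (auto simp: subspace_over_def)
    then show ?thesis using triv by force
  qed
  ultimately have "is_direct_sum W S (times c ` C)" unfolding is_direct_sum_def by blast
  then show ?thesis using that[OF c(1), of S] S_sub dim unfolding GF pw_eq C_def by blast
qed

lemma trace_perp_span_pair:
  "trace_perp q n (span_over K times {\<xi>, \<eta>}) = {y. Tr q n (\<xi> * y) = 0 \<and> Tr q n (\<eta> * y) = 0}"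
proof -
  have "Tr q n (x * y) = 0" if "x \<in> span_over K times {\<xi>, \<eta>}"
    "Tr q n (\<xi> * y) = 0" "Tr q n (\<eta> * y) = 0" for x y
  proof -
    have "span_over K times {\<xi>, \<eta>} \<subseteq> {x. Tr q n (y * x) = 0}"
      using that(2,3) by (intro K.span_over_minimal subspace_over_Tr_kernel) (simp add: mult.commute)
    then have "Tr q n (y * x) = 0" using that(1) by blast
    then show ?thesis by (simp add: mult.commute)
  qed
  then show ?thesis
    unfolding trace_perp_def using K.span_over_superset[of "{\<xi>, \<eta>}"] by auto
qed

end

section \<open>From the club condition to the normal form\<close>

theorem theorem7p2:
  fixes f :: "'a::{field,finite} poly" and q n :: nat
  assumes "primepow q"
    and "CARD('a) = q ^ n"
    and "n \<ge> 5"
    and "f \<in> q_polys q"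
    and "club_poly q (n - 2) f"
  shows "\<exists>b \<xi> \<eta> c :: 'a. \<exists>S :: 'a set. \<exists>t :: nat.
           b \<notin> GF q \<and> \<xi> \<noteq> 0 \<and> \<eta> \<noteq> 0 \<and> c \<noteq> 0 \<and>
           poly_equivalent q f (Tr q n [:0, \<xi>:] + smult b (Tr q n [:0, \<eta>:])) \<and>
           t = ext_degree (adjoin (GF q) b) (GF q) \<and>
           subspace_over (GF (q ^ t)) times S \<and>
           real (dim_over (GF (q ^ t)) times S) = real n / real t - 1 \<and>
           is_direct_sum (trace_perp q n (span_over (GF q) times {\<xi>, \<eta>}))
             S (times c ` span_over (GF q) times {b ^ i | i. i + 3 \<le> t})"
proof -
  interpret finite_field_extension q n "TYPE('a)"
    by unfold_locales (use assms in auto)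
  note f = assms(4)
  have n: "n \<ge> 2" using assms(3) by simp
  obtain m0 where m0: "card {x. poly f x = m0 * x} = q ^ (n - 2)"
    and small: "\<And>m. m \<noteq> m0 \<Longrightarrow> card {x. poly f x = m * x} \<le> q"
    using club_poly_eigenspaces[OF f assms(5)] by blast
  define g where "g x = poly f x - m0 * x" for x
  obtain a b \<xi> \<eta> where ab: "a \<noteq> 0" "b \<notin> K" "\<xi> \<noteq> 0" "\<eta> \<noteq> 0"
    and g: "\<And>x. g x = a * (Tr q n (\<xi> * x) + b * Tr q n (\<eta> * x))"
  proof (rule rank_two_map_eq_Tr[of g])
    show "g (x + y) = g x + g y" for x y
      by (simp add: g_def poly_q_poly_add[OF f] algebra_simps)
    show "g (k * x) = k * g x" if "k \<in> K" for k x
      using that by (simp add: g_def poly_q_poly_scale[OF f] algebra_simps)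
    show "card {x. g x = 0} = q ^ (n - 2)" using m0 by (simp add: g_def)
  qed (use n in auto)
  let ?W = "{y. Tr q n (\<xi> * y) = 0 \<and> Tr q n (\<eta> * y) = 0}"
  \<comment> \<open>Since \<open>1\<close> and \<open>b\<close> are independent over
    \<open>K\<close>, the kernel of \<open>g\<close> is exactly where both traces vanish.\<close>
  have "g x = 0 \<longleftrightarrow> x \<in> ?W" for x
    using coordinates_unique[OF ab(2) Tr_in_GF Tr_in_GF, of 0 0 "\<xi> * x" "\<eta> * x"] K.F_intros(1) ab(1)
    by (auto simp: g)
  then have "?W = {x. poly f x = m0 * x}" by (auto simp: g_def)
  then have card_W: "card ?W = q ^ (n - 2)" using m0 by simp

  \<comment> \<open>A solution \<open>z\<close> would give
    \<open>g (z * (x + b * y)) = a * (x + b * y)\<close> for all \<open>x\<close>, \<open>y\<close>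
    in \<open>K\<close>. So the slope \<open>m0 + a / z\<close>, different from \<open>m0\<close>,
    would have at least \<open>q * q\<close> solutions instead of at most \<open>q\<close>.\<close>
  have no: "\<not> (Tr q n (z * \<xi>) = 1 \<and> Tr q n (z * \<eta>) = 0 \<and>
      Tr q n (z * (\<xi> * b)) = 0 \<and> Tr q n (z * (\<eta> * b)) = 1)" for z
  proof
    assume z: "Tr q n (z * \<xi>) = 1 \<and> Tr q n (z * \<eta>) = 0 \<and>
      Tr q n (z * (\<xi> * b)) = 0 \<and> Tr q n (z * (\<eta> * b)) = 1"
    then have "z \<noteq> 0" by (auto simp: Tr_0)
    define m where "m = m0 + a / z"
    let ?h = "\<lambda>(x, y). z * (x + b * y)"
    have "poly f (z * (x + b * y)) = m * (z * (x + b * y))" if xy: "x \<in> K" "y \<in> K" for x y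
    proof -
      have "Tr q n (\<xi> * (z * (x + b * y))) = Tr q n (x * (z * \<xi>) + y * (z * (\<xi> * b)))"
        "Tr q n (\<eta> * (z * (x + b * y))) = Tr q n (x * (z * \<eta>) + y * (z * (\<eta> * b)))"
        by (simp_all add: algebra_simps)
      then have "g (z * (x + b * y)) = a * (x + b * y)"
        using z xy by (simp add: g Tr_add Tr_scale)
      then show ?thesis using \<open>z \<noteq> 0\<close> by (simp add: g_def m_def algebra_simps)
    qed
    then have "?h ` (K \<times> K) \<subseteq> {x. poly f x = m * x}" by auto
    then have "card (?h ` (K \<times> K)) \<le> card {x. poly f x = m * x}" by (intro card_mono) auto
    also have "\<dots> \<le> q" using small[of m] ab(1) \<open>z \<noteq> 0\<close> by (simp add: m_def)
    also have "card (?h ` (K \<times> K)) = q * q"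
    proof -
      have "inj_on ?h (K \<times> K)"
      proof (rule inj_onI, clarify)
        fix x y x' y' assume *: "x \<in> K" "y \<in> K" "x' \<in> K" "y' \<in> K"
          "z * (x + b * y) = z * (x' + b * y')"
        then have "x + b * y = x' + b * y'" using \<open>z \<noteq> 0\<close> by simp
        then show "x = x' \<and> y = y'" using coordinates_unique[OF ab(2) *(1-4)] by blast
      qed
      then show ?thesis by (simp add: card_image card_cartesian_product card_GF)
    qed
    finally show False using q_gt_1 by simp
  qed
  obtain \<alpha> \<beta> \<gamma> \<delta> where K: "\<alpha> \<in> K" "\<beta> \<in> K" "\<gamma> \<in> K" "\<delta> \<in> K" and "\<alpha> + \<delta> \<noteq> 0"
    "\<alpha> * \<xi> + \<beta> * \<eta> + \<gamma> * (\<xi> * b) + \<delta> * (\<eta> * b) = 0"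
    using relation_from_unsolvable_system[OF no] by blast
  then obtain d where d: "d \<noteq> 0" "\<xi> = d * (\<beta> + b * \<delta>)" "\<eta> = d * (- \<alpha> + b * - \<gamma>)"
    using relation_imp_common_multiple[OF _ _ _ _ _ _ ab(2,4)] by blast
  \<comment> \<open>Both \<open>\<xi>\<close> and \<open>\<eta>\<close> are
    \<open>K\<close>-combinations of \<open>d\<close> and \<open>d * b\<close>, so orthogonality to
    these two suffices.\<close>
  have W: "y \<in> ?W" if y: "Tr q n (d * y) = 0" "Tr q n (d * (b * y)) = 0" for y
  proof -
    have "Tr q n (d * (k1 + b * k2) * y) = 0" if "k1 \<in> K" "k2 \<in> K" for k1 k2
    proof -
      have "Tr q n (d * (k1 + b * k2) * y) = Tr q n (k1 * (d * y) + k2 * (d * (b * y)))"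
        by (simp add: algebra_simps)
      then show ?thesis using y that by (simp add: Tr_add Tr_scale)
    qed
    then show ?thesis unfolding d(2,3) using K K.F_intros(7) by blast
  qed
  let ?t = "ext_degree (adjoin K b) K"
  obtain c S where c: "c \<noteq> 0" "subspace_over (GF (q ^ ?t)) times S"
    "real (dim_over (GF (q ^ ?t)) times S) = real n / real ?t - 1"
    "is_direct_sum ?W S (times c ` span_over K times {b ^ i | i. i + 3 \<le> ?t})"
    using perp_decomposition[OF ab(2) d(1) W card_W] by blast
  \<comment> \<open>Undoing the definition of \<open>g\<close> exhibits \<open>f\<close> in the
    shape required by \<open>poly_equivalent_affine\<close>.\<close>
  have "poly f x = m0 * x + a * poly (Tr q n [:0, \<xi>:] + smult b (Tr q n [:0, \<eta>:])) x" for x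
    using g[of x] by (simp add: g_def poly_Tr_linear algebra_simps)
  then have "poly_equivalent q f (Tr q n [:0, \<xi>:] + smult b (Tr q n [:0, \<eta>:]))"
    using poly_equivalent_affine[OF f Tr_combination_in_q_polys ab(1)] by blast
  then show ?thesis using ab c unfolding trace_perp_span_pair by blast
qed

end
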